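(* Let $\alpha,\zeta,\delta>0$ and let $X,Y$ be independent, identically distributed real random variables following the zero-mean symmetric K-distribution with density $$f(x)=\frac{\delta^{\frac{\alpha+\zeta}{2}}}{\Gamma(\alpha)\Gamma(\zeta)}\,|x|^{\frac{\alpha+\zeta}{2}-1}K_{\alpha-\zeta}\left(2\sqrt{\delta|x|}\right).$$ Then the probability density function of the product $Z=XY$ is given by $$f_Z(z)=\frac{\delta^{\alpha+\zeta}\,|z|^{\frac{\alpha+\zeta}{2}-1}}{2\left[\Gamma(\alpha)\Gamma(\zeta)\right]^2}\;G_{0,4}^{4,0}\left(\delta|z|\;\middle|\;\begin{array}{c}-\\ \frac{\alpha-\zeta}{2},\,-\frac{\alpha-\zeta}{2},\,\frac{\alpha-\zeta}{2},\,-\frac{\alpha-\zeta}{2}\end{array}\right).$$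
   Context: $\Gamma$ is the Gamma function; $K_\nu$ is the modified Bessel function of the second kind of order $\nu$. The symmetric K-distribution has in general a location parameter $\gamma$, which is its mean (its density is the one above with $|x|$ replaced by $|x-\gamma|$); zero mean corresponds to $\gamma=0$. $G_{p,q}^{m,n}$ is the Meijer G-function: for $x>0$, $$G_{p,q}^{m,n}\left(x\;\middle|\;\begin{array}{c}a_1,\dots,a_p\\ b_1,\dots,b_q\end{array}\right)=\frac{1}{2\pi i}\int_L \frac{\prod_{j=1}^m\Gamma(b_j-s)\prod_{j=1}^n\Gamma(1-a_j+s)}{\prod_{j=m+1}^q\Gamma(1-b_j+s)\prod_{j=n+1}^p\Gamma(a_j-s)}\,x^s\,ds,$$ where empty products equal $1$, a dash denotes an empty parameter list, and $L$ runs from $-i\infty$ to $+i\infty$, with all poles of $\Gamma(b_j-s)$, $1\le j\le m$, on its right and all poles of $\Gamma(1-a_j+s)$, $1\le j\le n$, on its left.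
   Formalization: The argument of the Meijer G-function is δ²|z| instead of the printed δ|z|; with δ|z| the formula integrates to δ^((α+ζ)/2), so it is not a probability density unless δ=1, where both agree. *)

theory Defs
  imports "HOL-Probability.Probability"
begin

text \<open>
  Modified Bessel function of the second kind, for real order and \<open>x > 0\<close>, by its standard
  integral representation.
\<close>

definition Bessel_K :: "real \<Rightarrow> real \<Rightarrow> real" where
  "Bessel_K \<nu> x = (LBINT t:{0..}. exp (- x * cosh t) * cosh (\<nu> * t))"

text \<open>
  The parameter \<open>\<delta>\<close> is an inverse scale: if \<open>X\<close> has this density, then \<open>\<delta> X\<close> has the density
  with \<open>\<delta>\<close> replaced by \<open>1\<close>.  Consequently a product of two independent such variables has
  inverse scale \<open>\<delta>\<^sup>2\<close>.
\<close>

definition sym_K_density :: "real \<Rightarrow> real \<Rightarrow> real \<Rightarrow> real \<Rightarrow> real" where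
  "sym_K_density \<alpha> \<zeta> \<delta> x =
     \<delta> powr ((\<alpha> + \<zeta>) / 2) / (Gamma \<alpha> * Gamma \<zeta>) * \<bar>x\<bar> powr ((\<alpha> + \<zeta>) / 2 - 1)
       * Bessel_K (\<alpha> - \<zeta>) (2 * sqrt (\<delta> * \<bar>x\<bar>))"

text \<open>
  A contour from \<open>-\<i>\<infinity>\<close> to \<open>+\<i>\<infinity>\<close> is a simple, locally piecewise \<open>C\<^sup>1\<close> curve, parametrised by the
  real line, that stays in a vertical strip.  Its complement then has one component containing
  the far left half plane and one containing the far right half plane; these are the two sides
  of the contour.
\<close>

definition vertical_contour :: "(real \<Rightarrow> complex) \<Rightarrow> bool" where
  "vertical_contour L \<longleftrightarrow>
     (\<forall>a b. L piecewise_C1_differentiable_on {a..b}) \<and> inj L \<and>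
     bounded (range (\<lambda>t. Re (L t))) \<and>
     filterlim (\<lambda>t. Im (L t)) at_bot at_bot \<and>
     filterlim (\<lambda>t. Im (L t)) at_top at_top"

definition left_of_contour :: "(real \<Rightarrow> complex) \<Rightarrow> complex set" where
  "left_of_contour L = {s. \<exists>R. \<forall>w. Re w < R \<longrightarrow> connected_component (- range L) s w}"

definition right_of_contour :: "(real \<Rightarrow> complex) \<Rightarrow> complex set" where
  "right_of_contour L = {s. \<exists>R. \<forall>w. Re w > R \<longrightarrow> connected_component (- range L) s w}"

text \<open>
  In the Meijer G-function \<open>meijer_G m n as bs\<close> the orders \<open>p\<close> and \<open>q\<close> are the lengths of the
  parameter lists \<open>as\<close> and \<open>bs\<close>; it is meant for \<open>m \<le> q\<close>, \<open>n \<le> p\<close> and positive real argument.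
  The poles of \<open>Gamma (b - s)\<close> are the points \<open>s\<close> with \<open>b - s\<close> a nonpositive integer.
  At the poles of a Gamma factor in the denominator, \<open>Gamma\<close> and division are totalised so that
  the reciprocal is \<open>0\<close>, which is the correct value.
\<close>

definition meijer_G_contour ::
    "nat \<Rightarrow> nat \<Rightarrow> complex list \<Rightarrow> complex list \<Rightarrow> (real \<Rightarrow> complex) \<Rightarrow> bool" where
  "meijer_G_contour m n as bs L \<longleftrightarrow>
     vertical_contour L \<and>
     (\<forall>b\<in>set (take m bs). \<forall>s. b - s \<in> \<int>\<^sub>\<le>\<^sub>0 \<longrightarrow> s \<in> right_of_contour L) \<and>
     (\<forall>a\<in>set (take n as). \<forall>s. 1 - a + s \<in> \<int>\<^sub>\<le>\<^sub>0 \<longrightarrow> s \<in> left_of_contour L)"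

definition meijer_G_integrand ::
    "nat \<Rightarrow> nat \<Rightarrow> complex list \<Rightarrow> complex list \<Rightarrow> real \<Rightarrow> complex \<Rightarrow> complex" where
  "meijer_G_integrand m n as bs x s =
     ((\<Prod>b\<leftarrow>take m bs. Gamma (b - s)) * (\<Prod>a\<leftarrow>take n as. Gamma (1 - a + s)))
     / ((\<Prod>b\<leftarrow>drop m bs. Gamma (1 - b + s)) * (\<Prod>a\<leftarrow>drop n as. Gamma (a - s)))
     * complex_of_real x powr s"

text \<open>
  The Henstock--Kurzweil integral over the real line is the improper contour integral, as in
  \<open>has_contour_integral\<close>.  When \<open>m + n > (p + q) / 2\<close>
  the integrand decays in vertical strips and the value does not depend on the admissible contour.
\<close>

definition has_meijer_G ::
    "nat \<Rightarrow> nat \<Rightarrow> complex list \<Rightarrow> complex list \<Rightarrow> real \<Rightarrow> complex \<Rightarrow> bool" where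
  "has_meijer_G m n as bs x v \<longleftrightarrow>
     (\<exists>L I. meijer_G_contour m n as bs L \<and>
        ((\<lambda>t. meijer_G_integrand m n as bs x (L t) * vector_derivative L (at t))
           has_integral I) UNIV \<and>
        v = 1 / (2 * of_real pi * \<i>) * I)"

definition meijer_G :: "nat \<Rightarrow> nat \<Rightarrow> complex list \<Rightarrow> complex list \<Rightarrow> real \<Rightarrow> complex" where
  "meijer_G m n as bs x = (THE v. has_meijer_G m n as bs x v)"

end

theory Submission
  imports Defs "HOL-Complex_Analysis.Cauchy_Integral_Formula"
begin

text \<open>
  With \<open>W = ln \<bar>XY\<bar>\<close> the product becomes a sum.  The law of \<open>ln (\<delta> \<bar>X\<bar>)\<close> is that of the logarithm of a
  product of two independent Gamma variables with parameters \<open>\<alpha>\<close> and \<open>\<zeta>\<close>, so \<open>W\<close> has the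
  characteristic function
  \<open>\<delta>\<^bsup>- 2it\<^esup> (\<Gamma>(\<alpha> + it) \<Gamma>(\<zeta> + it) / (\<Gamma>(\<alpha>) \<Gamma>(\<zeta>)))\<^bsup>2\<^esup>\<close>,
  which is integrable.  Levy's inversion formula then writes the density of \<open>W\<close> as an integral that is
  exactly the Mellin--Barnes integral over the line \<open>Re s = - (\<alpha> + \<zeta>) / 2\<close>, and since \<open>Z = XY\<close> is
  symmetric its density is \<open>f\<^sub>W (ln \<bar>z\<bar>) / (2 \<bar>z\<bar>)\<close>.  The Mellin--Barnes integral takes the same value on
  every admissible contour, because the integrand decays in vertical strips and a truncated contour can
  be closed on the far left without winding around a pole.
\<close>

section \<open>Shifting contours to the far left\<close>

text \<open>\<open>meijer_G\<close> is a definite description, so a computation on one convenient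
  line says nothing until every admissible curve is known to give the same value. Two admissible
  curves need not be comparable with each other, and the integrand has infinitely many poles. Two
  facts tame this: all numerator factors have the form Gamma (b - s), so vertical lines far to the
  left meet no pole; and only finitely many poles have real part up to the rightmost reach of a
  given curve. Each curve is compared with far left lines, and two curves with a line that is far
  left for both. The line Re s = -(\<alpha> + \<zeta>) / 2 comes from the probabilistic side: on it
  the parameters (\<alpha> - \<zeta>) / 2 and -(\<alpha> - \<zeta>) / 2 turn Gamma (b - s) into
  Gamma (\<alpha> - it) and Gamma (\<zeta> - it). Each parameter occurs twice because X and Y each
  contribute both factors.\<close>

lemma tendsto_integral_Icc_UNIV:
  fixes g :: "real \<Rightarrow> complex"
  assumes g: "(g has_integral I) UNIV"
    and a: "filterlim a at_bot F" and b: "filterlim b at_top F"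
  shows "((\<lambda>n. integral {a n..b n} g) \<longlongrightarrow> I) F"
proof (rule tendstoI)
  fix e :: real assume "e > 0"
  with g obtain B where
    *: "\<And>a b. ball 0 B \<subseteq> cbox a b \<Longrightarrow> norm (integral (cbox a b) g - I) < e"
    unfolding has_integral_alt'[of g I UNIV] by force
  have "eventually (\<lambda>n. a n \<le> -B) F" using a by (simp add: filterlim_at_bot)
  moreover have "eventually (\<lambda>n. b n \<ge> B) F" using b by (simp add: filterlim_at_top)
  ultimately show "eventually (\<lambda>n. dist (integral {a n..b n} g) I < e) F"
  proof eventually_elim
    case (elim n)
    have "ball 0 B \<subseteq> cbox (a n) (b n)" using elim by (auto simp: dist_norm)
    from *[OF this] show ?case by (simp add: dist_norm)
  qed
qed

text \<open>Library contour integrals run over [0,1] with the derivative taken within that interval,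
  whereas curves here are parametrised by the whole line. The finite set \<open>?S\<close> removes
  the break points of \<open>L\<close> and the ends.\<close>

lemma has_contour_integral_affine:
  fixes L :: "real \<Rightarrow> complex"
  assumes L: "L piecewise_C1_differentiable_on {a..b}" and ab: "a < b"
    and J: "((\<lambda>t. f (L t) * vector_derivative L (at t)) has_integral J) {a..b}"
  shows "(f has_contour_integral J) (L \<circ> (\<lambda>x. (b - a) *\<^sub>R x + a))"
    and "valid_path (L \<circ> (\<lambda>x. (b - a) *\<^sub>R x + a))"
proof -
  define m where "m = b - a"
  have m: "m > 0" using ab by (simp add: m_def)
  have im: "(\<lambda>x. m * x + a) ` {0..1} = {a..b}"
    using ab by (simp add: m_def image_affinity_atLeastAtMost)
  show "valid_path (L \<circ> (\<lambda>x. (b - a) *\<^sub>R x + a))"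
    unfolding valid_path_def
    using L im by (intro piecewise_C1_differentiable_affine) (simp add: m_def)
  obtain S where S: "finite S" "L C1_differentiable_on ({a..b} - S)"
    using L unfolding piecewise_C1_differentiable_on_def by blast
  let ?h = "\<lambda>t. f (L t) * vector_derivative L (at t)"
  have "((\<lambda>x. ?h (m *\<^sub>R x + a)) has_integral (J /\<^sub>R m ^ DIM(real))) (cbox ((a - a) /\<^sub>R m) ((b - a) /\<^sub>R m))"
    by (rule has_integral_affinity') (use J m in auto)
  hence "((\<lambda>x. ?h (m * x + a)) has_integral (J /\<^sub>R m)) {0..1}"
    using m by (simp add: m_def)
  from has_integral_cmul[OF this, of m] have 1: "((\<lambda>x. m *\<^sub>R ?h (m * x + a)) has_integral J) {0..1}"
    using m by simp
  let ?S = "{0,1} \<union> (\<lambda>x. (x - a) / m) ` S"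
  have "((\<lambda>x. f ((L \<circ> (\<lambda>x. m *\<^sub>R x + a)) x) *
      vector_derivative (L \<circ> (\<lambda>x. m *\<^sub>R x + a)) (at x within {0..1})) has_integral J) {0..1}"
  proof (rule has_integral_spike_finite[OF _ _ 1])
    show "finite ?S" using S by auto
    fix x assume x: "x \<in> {0..1} - ?S"
    have "m * x + a \<notin> S" using x m by (force simp: image_iff)
    moreover have "m * x + a \<in> {a..b}" using x im by blast
    ultimately have d: "L differentiable (at (m * x + a))"
      using S by (auto simp: C1_differentiable_on_eq)
    have der: "(L \<circ> (\<lambda>x. m *\<^sub>R x + a) has_vector_derivative
              m *\<^sub>R vector_derivative L (at (m * x + a))) (at x)"
    proof -
      have "((\<lambda>x. m *\<^sub>R x + a) has_vector_derivative m) (at x)"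
        by (auto intro!: derivative_eq_intros)
      from vector_diff_chain_at[OF this, of L "vector_derivative L (at (m * x + a))"] d
      show ?thesis by (simp add: vector_derivative_works)
    qed
    have "vector_derivative (L \<circ> (\<lambda>x. m *\<^sub>R x + a)) (at x within {0..1})
        = m *\<^sub>R vector_derivative L (at (m * x + a))"
      using x by (intro vector_derivative_at_within_ivl[OF der]) auto
    thus "f ((L \<circ> (\<lambda>x. m *\<^sub>R x + a)) x) *
      vector_derivative (L \<circ> (\<lambda>x. m *\<^sub>R x + a)) (at x within {0..1}) = m *\<^sub>R ?h (m * x + a)"
      by simp
  qed
  thus "(f has_contour_integral J) (L \<circ> (\<lambda>x. (b - a) *\<^sub>R x + a))"
    by (simp add: has_contour_integral_def m_def)
qed

section \<open>Topology of admissible contours\<close>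

lemma vertical_contour_continuous:
  assumes "vertical_contour L" shows "continuous_on UNIV L"
proof -
  have "isCont L t" for t
  proof -
    have "continuous_on {t-1..t+1} L"
      using assms by (auto simp: vertical_contour_def piecewise_C1_differentiable_on_def)
    hence "continuous_on {t-1<..<t+1} L" by (rule continuous_on_subset) auto
    thus ?thesis by (simp add: continuous_on_eq_continuous_at)
  qed
  thus ?thesis by (simp add: continuous_at_imp_continuous_on)
qed

text \<open>As Im (L t) tends to both infinities, a bounded set of curve points has its parameters
  in a compact interval, so limits stay on the curve. The complement is thus open, and its
  components are path components.\<close>

lemma vertical_contour_closed_range:
  assumes "vertical_contour L" shows "closed (range L)"
proof (rule closed_sequential_limits[THEN iffD2], intro allI impI; elim conjE)
  fix x l assume x: "\<forall>n. x n \<in> range L" and l: "x \<longlonglongrightarrow> l"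
  have "\<forall>n. \<exists>t. x n = L t" using x by (auto simp: image_iff)
  then obtain t where t: "\<And>n. x n = L (t n)" by (auto dest: choice)
  have "bounded (range x)" using l by (rule convergent_imp_bounded)
  then obtain K where K: "\<And>n. norm (x n) \<le> K" by (auto simp: bounded_iff)
  have "eventually (\<lambda>s. Im (L s) > K) at_top" "eventually (\<lambda>s. Im (L s) < -K) at_bot"
    using assms unfolding vertical_contour_def filterlim_at_top_dense filterlim_at_bot_dense by blast+
  then obtain p q where p: "\<And>s. s \<ge> p \<Longrightarrow> Im (L s) > K" and q: "\<And>s. s \<le> q \<Longrightarrow> Im (L s) < -K"
    by (auto simp: eventually_at_top_linorder eventually_at_bot_linorder)
  have "t n \<in> {q..p}" for n
  proof -
    have "\<bar>Im (L (t n))\<bar> \<le> K" using K[of n] abs_Im_le_cmod[of "x n"] unfolding t by linarith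
    thus ?thesis using p[of "t n"] q[of "t n"] by (cases "t n \<le> q"; cases "t n \<ge> p") auto
  qed
  hence "x n \<in> L ` {q..p}" for n by (auto simp: t)
  moreover have "closed (L ` {q..p})"
    by (intro compact_imp_closed compact_continuous_image)
       (auto intro: continuous_on_subset[OF vertical_contour_continuous[OF assms]])
  ultimately have "l \<in> L ` {q..p}" using l closed_sequentially by blast
  thus "l \<in> range L" by auto
qed

text \<open>Replaces a connectedness statement by a path, whose compactness later keeps it inside a
  ball that the closing segments avoid.\<close>

lemma right_of_contour_path:
  assumes L: "vertical_contour L" and p: "p \<in> right_of_contour L"
  obtains g where "path g" "pathstart g = p" "Re (pathfinish g) > R" "path_image g \<inter> range L = {}"
proof -
  from p obtain S where S: "\<And>w. Re w > S \<Longrightarrow> connected_component (- range L) p w"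
    unfolding right_of_contour_def by blast
  define w where "w = complex_of_real (max R S + 1)"
  have "connected_component (- range L) p w" by (rule S) (simp add: w_def)
  hence "path_component (- range L) p w"
    using open_path_connected_component[OF open_Compl[OF vertical_contour_closed_range[OF L]]] by metis
  then obtain g where "path g" "path_image g \<subseteq> - range L" "pathstart g = p" "pathfinish g = w"
    unfolding path_component_def by blast
  moreover have "Re w > R" by (simp add: w_def)
  ultimately show ?thesis using that[of g] by blast
qed

lemma integrable_decay_square:
  fixes g :: "real \<Rightarrow> complex"
  assumes g: "continuous_on UNIV g" and C: "\<And>t. 1 \<le> \<bar>t\<bar> \<Longrightarrow> norm (g t) \<le> C / t\<^sup>2"
  shows "integrable lborel g"
proof -
  have "compact (g ` {-1..1})"
    by (intro compact_continuous_image continuous_on_subset[OF g]) auto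
  hence "bounded (g ` {-1..1})" by (rule compact_imp_bounded)
  then obtain M where "\<forall>x\<in>g ` {-1..1}. norm x \<le> M" unfolding bounded_iff by blast
  hence M: "\<And>t. \<bar>t\<bar> \<le> 1 \<Longrightarrow> norm (g t) \<le> M" by (simp add: abs_le_iff)
  \<comment> \<open>The 2 absorbs 1 + t^2 \<le> 2 for |t| \<le> 1 and 1 + t^2 \<le> 2 t^2 for |t| >
    1.\<close>
  define K where "K = 2 * max \<bar>M\<bar> \<bar>C\<bar>"
  have bound: "norm (g t) \<le> K * inverse (1 + t\<^sup>2)" for t
  proof (cases "\<bar>t\<bar> \<le> 1")
    case True
    have "norm (g t) * (1 + t\<^sup>2) \<le> max \<bar>M\<bar> \<bar>C\<bar> * 2"
      using M[OF True] True by (intro mult_mono) (auto simp: abs_square_le_1)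
    thus ?thesis by (simp add: K_def field_simps add_pos_nonneg)
  next
    case False
    hence t: "t\<^sup>2 \<ge> 1" using abs_square_le_1[of t] by linarith
    have "norm (g t) * (1 + t\<^sup>2) \<le> (\<bar>C\<bar> / t\<^sup>2) * (2 * t\<^sup>2)"
      using C[of t] False t by (intro mult_mono) (auto simp: divide_right_mono intro: order_trans)
    also have "\<dots> = 2 * \<bar>C\<bar>" using t by auto
    also have "\<dots> \<le> K" by (simp add: K_def)
    finally show ?thesis by (simp add: field_simps add_pos_nonneg)
  qed
  have "integrable lborel (\<lambda>t::real. K * inverse (1 + t\<^sup>2))"
    using integrable_inverse_1_plus_square by (simp add: set_integrable_def)
  thus ?thesis
  proof (rule Bochner_Integration.integrable_bound)
    show "g \<in> borel_measurable lborel" using g by (simp add: borel_measurable_continuous_onI)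
    show "AE t in lborel. norm (g t) \<le> norm (K * inverse (1 + t\<^sup>2))"
      using bound by (auto intro!: AE_I2 order_trans[OF bound])
  qed
qed

text \<open>What the shift asks of an integrand with poles in \<open>P\<close>. By
  \<open>finite_left\<close> only finitely many poles need individual care. The quadratic decay
  serves twice: integrability along vertical lines, and vanishing of the horizontal
  segments.\<close>

locale contour_integrand =
  fixes f :: "complex \<Rightarrow> complex" and P :: "complex set"
  assumes closed: "closed P"
    and finite_left: "\<And>R. finite {p \<in> P. Re p \<le> R}"
    and holo: "f holomorphic_on - P"
    and decay: "\<And>A B. \<exists>C. \<forall>s. A \<le> Re s \<and> Re s \<le> B \<and> 1 \<le> \<bar>Im s\<bar> \<longrightarrow> norm (f s) \<le> C / (Im s)\<^sup>2"
begin

lemma integrable_vertical_line: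
  assumes "\<And>p. p \<in> P \<Longrightarrow> Re p \<noteq> c"
  shows "integrable lborel (\<lambda>t. f (Complex c t))"
proof -
  have cont: "continuous_on UNIV (\<lambda>t. Complex c t)"
    unfolding Complex_eq by (intro continuous_intros)
  from decay[of c c] obtain C where C: "\<And>s. Re s = c \<Longrightarrow> 1 \<le> \<bar>Im s\<bar> \<Longrightarrow> norm (f s) \<le> C / (Im s)\<^sup>2"
    by auto
  show ?thesis
  proof (rule integrable_decay_square)
    have "continuous_on (- P) f" using holo by (rule holomorphic_on_imp_continuous_on)
    thus "continuous_on UNIV (\<lambda>t. f (Complex c t))"
      by (rule continuous_on_compose2[OF _ cont]) (use assms in force)
    show "norm (f (Complex c t)) \<le> C / t\<^sup>2" if "1 \<le> \<bar>t\<bar>" for t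
      using C[of "Complex c t"] that by simp
  qed
qed

text \<open>
  A truncation of the contour is closed up far to the left.  A path joining a pole to the far right
  without meeting the contour is compact, hence misses the closed path altogether if that is large
  enough, so the winding number around every pole vanishes.
\<close>

lemma closed_truncation:
  assumes L: "vertical_contour L" and P: "P \<subseteq> right_of_contour L"
    and B: "\<And>t. \<bar>Re (L t)\<bar> \<le> B"
    and N: "\<And>p. p \<in> P \<Longrightarrow> Re p \<le> B \<Longrightarrow> \<exists>g. path g \<and> pathstart g = p \<and> Re (pathfinish g) > B \<and>
             path_image g \<inter> range L = {} \<and> (\<forall>z\<in>path_image g. norm z \<le> N)"
    and c: "c < - B" "c < - N" and N0: "N \<ge> 0"
    and ab: "a < b" "Im (L a) < - N" "Im (L b) > N"
    and J: "((\<lambda>t. f (L t) * vector_derivative L (at t)) has_integral J) {a..b}"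
    and C: "\<And>s. c \<le> Re s \<Longrightarrow> Re s \<le> B \<Longrightarrow> \<bar>Im s\<bar> \<ge> min \<bar>Im (L a)\<bar> \<bar>Im (L b)\<bar> \<Longrightarrow> norm (f s) \<le> C"
  shows "norm (J - \<i> * integral {Im (L a)..Im (L b)} (\<lambda>t. f (Complex c t))) \<le> 2 * C * (B - c)"
proof -
  define g1 where "g1 = L \<circ> (\<lambda>x. (b - a) *\<^sub>R x + a)"
  define ua where "ua = Complex c (Im (L a))"
  define ub where "ub = Complex c (Im (L b))"
  \<comment> \<open>From L a along the curve to L b, left to Re = c, down that line, and right again
    to L a.\<close>
  define \<gamma> where "\<gamma> = g1 +++ (linepath (L b) ub +++ (linepath ub ua +++ linepath ua (L a)))"
  have pw: "L piecewise_C1_differentiable_on {a..b}" using L by (simp add: vertical_contour_def)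
  note g1 = has_contour_integral_affine[OF pw ab(1) J, folded g1_def]
  have ends: "pathstart g1 = L a" "pathfinish g1 = L b"
    by (simp_all add: g1_def pathstart_def pathfinish_def)
  have vp: "valid_path \<gamma>" using g1(2) by (auto simp: \<gamma>_def ends intro!: valid_path_join)
  have loop: "pathfinish \<gamma> = pathstart \<gamma>" by (simp add: \<gamma>_def ends)
  have "path_image g1 \<subseteq> range L" by (auto simp: g1_def path_image_def)
  have Bc: "B \<ge> 0" using B[of 0] by linarith
  have pi: "path_image \<gamma> \<subseteq> range L \<union> (closed_segment (L b) ub \<union> closed_segment ub ua \<union> closed_segment ua (L a))"
    using \<open>path_image g1 \<subseteq> range L\<close> by (auto simp: \<gamma>_def ends path_image_join)
  have segb: "Im z = Im (L b) \<and> c \<le> Re z \<and> Re z \<le> B" if "z \<in> closed_segment (L b) ub" for z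
    using that B[of b] c
    by (auto simp: closed_segment_same_Im ub_def closed_segment_eq_real_ivl abs_le_iff split: if_splits)
  have sega: "Im z = Im (L a) \<and> c \<le> Re z \<and> Re z \<le> B" if "z \<in> closed_segment ua (L a)" for z
    using that B[of a] c
    by (auto simp: closed_segment_same_Im ua_def closed_segment_eq_real_ivl abs_le_iff split: if_splits)
  have segc: "Re z = c" if "z \<in> closed_segment ub ua" for z
    using that by (auto simp: closed_segment_same_Re ua_def ub_def)
  have Re_le: "Re z \<le> B" if z: "z \<in> path_image \<gamma>" for z
  proof -
    consider "z \<in> range L" | "z \<in> closed_segment (L b) ub" | "z \<in> closed_segment ub ua" | "z \<in> closed_segment ua (L a)"
      using pi z by blast
    thus ?thesis
    proof cases
      case 1
      then obtain t where "z = L t" by blast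
      thus ?thesis using abs_le_D1[OF B[of t]] by simp
    next
      case 2 thus ?thesis using segb[of z] by simp
    next
      case 3 thus ?thesis using segc[of z] c Bc by simp
    next
      case 4 thus ?thesis using sega[of z] by simp
    qed
  qed
  \<comment> \<open>The whole loop lies in the convex half plane Re \<le> B.\<close>
  have wn0: "winding_number \<gamma> z = 0" if "Re z > B" for z
  proof (rule winding_number_zero_outside)
    show "path \<gamma>" using vp by (rule valid_path_imp_path)
    show "convex {z. Re z \<le> B}" by (rule convex_halfspace_Re_le)
    show "pathfinish \<gamma> = pathstart \<gamma>" by (rule loop)
    show "z \<notin> {z. Re z \<le> B}" using that by simp
    show "path_image \<gamma> \<subseteq> {z. Re z \<le> B}" using Re_le by blast
  qed
  \<comment> \<open>The three added segments avoid the ball of radius \<open>N\<close>: the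
    horizontal ones have |Im| > N, the vertical one has Re = c < -N.\<close>
  have miss: "z \<notin> path_image \<gamma>" if z: "z \<notin> range L" "norm z \<le> N" for z
  proof
    assume "z \<in> path_image \<gamma>"
    then consider "z \<in> closed_segment (L b) ub" | "z \<in> closed_segment ub ua" | "z \<in> closed_segment ua (L a)"
      using pi z by blast
    thus False
      using segb[of z] sega[of z] segc[of z] ab c z(2) abs_Re_le_cmod[of z] abs_Im_le_cmod[of z]
      by cases linarith+
  qed
  \<comment> \<open>The escape path \<open>g\<close> avoids both the curve and the segments, so the
    winding number is constant along it and equals its value 0 at the far end. Poles with Re > B are
    outside already.\<close>
  have pole: "p \<notin> path_image \<gamma> \<and> winding_number \<gamma> p = 0" if p: "p \<in> P" for p
  proof (cases "Re p \<le> B")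
    case True
    from N[OF p True] obtain g where g: "path g" "pathstart g = p" "Re (pathfinish g) > B"
      "path_image g \<inter> range L = {}" "\<forall>z\<in>path_image g. norm z \<le> N" by blast
    have dis: "path_image g \<inter> path_image \<gamma> = {}" using miss g by blast
    have "winding_number \<gamma> p = winding_number \<gamma> (pathfinish g)"
      by (rule winding_number_eq[OF valid_path_imp_path[OF vp] loop, of _ "path_image g"])
         (use g dis in \<open>auto simp: connected_path_image\<close>)
    thus ?thesis using wn0[OF g(3)] dis g(2) pathstart_in_path_image[of g] by auto
  next
    case False
    thus ?thesis using wn0[of p] Re_le[of p] by auto
  qed
  have zero: "(f has_contour_integral 0) \<gamma>"
  proof (rule Cauchy_theorem_global[OF _ holo vp loop])
    show "open (- P)" using closed by (simp add: open_Compl)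
  qed (use pole in auto)
  hence "f contour_integrable_on \<gamma>" by (auto simp: contour_integrable_on_def)
  hence int: "f contour_integrable_on linepath (L b) ub" "f contour_integrable_on linepath ub ua"
      "f contour_integrable_on linepath ua (L a)"
    using g1(2) by (auto simp: \<gamma>_def ends)
  have "0 = contour_integral \<gamma> f" using zero by (simp add: contour_integral_unique)
  also have "\<dots> = J + (contour_integral (linepath (L b) ub) f + (contour_integral (linepath ub ua) f
                + contour_integral (linepath ua (L a)) f))"
    using int g1 contour_integral_unique[OF g1(1)]
    by (simp add: \<gamma>_def ends has_contour_integral_integrable[OF g1(1)])
  also have "contour_integral (linepath ub ua) f = - contour_integral (linepath ua ub) f"
    using contour_integral_reversepath[of "linepath ua ub" f] by simp
  also have "contour_integral (linepath ua ub) f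
      = \<i> * integral {Im (L a)..Im (L b)} (\<lambda>t. f (Complex c t))"
    by (rule contour_integral_linepath_same_Re) (use ab N0 in \<open>auto simp: ua_def ub_def\<close>)
  finally have eq: "J - \<i> * integral {Im (L a)..Im (L b)} (\<lambda>t. f (Complex c t))
      = - (contour_integral (linepath (L b) ub) f + contour_integral (linepath ua (L a)) f)"
    by (simp add: algebra_simps eq_neg_iff_add_eq_0)
  \<comment> \<open>The bound applies at the point L b itself, where it dominates a norm.\<close>
  have C0: "C \<ge> 0" using order_trans[OF norm_ge_zero C[of "L b"]] B[of b] c by auto
  have "norm (contour_integral (linepath (L b) ub) f) \<le> C * norm (ub - L b)"
  proof (rule contour_integral_bound_linepath[OF int(1) C0])
    show "norm (f z) \<le> C" if "z \<in> closed_segment (L b) ub" for z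
      using segb[OF that] by (intro C) auto
  qed
  moreover have "norm (contour_integral (linepath ua (L a)) f) \<le> C * norm (L a - ua)"
  proof (rule contour_integral_bound_linepath[OF int(3) C0])
    show "norm (f z) \<le> C" if "z \<in> closed_segment ua (L a)" for z
      using sega[OF that] by (intro C) auto
  qed
  moreover have "norm (ub - L b) \<le> B - c" "norm (L a - ua) \<le> B - c"
    using B[of a] B[of b] c by (auto simp: ua_def ub_def cmod_def abs_le_iff)
  ultimately have "norm (contour_integral (linepath (L b) ub) f) \<le> C * (B - c)"
     "norm (contour_integral (linepath ua (L a)) f) \<le> C * (B - c)"
    using C0 by (meson mult_left_mono order_trans)+
  thus ?thesis unfolding eq norm_minus_cancel
    using norm_triangle_ineq[of "contour_integral (linepath (L b) ub) f" "contour_integral (linepath ua (L a)) f"]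
    by linarith
qed


text \<open>The threshold \<open>c0\<close> depends on the curve; claiming the equation for every c
  below it lets two curves be compared on a common line.\<close>

lemma contour_shift_left:
  assumes L: "vertical_contour L" and P: "P \<subseteq> right_of_contour L"
    and I: "((\<lambda>t. f (L t) * vector_derivative L (at t)) has_integral I) UNIV"
  obtains c0 where "\<And>c. c < c0 \<Longrightarrow> I = \<i> * (LBINT t. f (Complex c t))"
proof -
  from L obtain B where B: "\<And>t. \<bar>Re (L t)\<bar> \<le> B"
    unfolding vertical_contour_def bounded_iff by auto
  define Q where "Q = {p \<in> P. Re p \<le> B}"
  have Q: "finite Q" unfolding Q_def by (rule finite_left)
  have "\<exists>g. path g \<and> pathstart g = p \<and> Re (pathfinish g) > B \<and> path_image g \<inter> range L = {}" if "p \<in> Q" for p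
    using right_of_contour_path[OF L, of p B] P that unfolding Q_def by blast
  then obtain g where g: "\<And>p. p \<in> Q \<Longrightarrow> path (g p) \<and> pathstart (g p) = p \<and>
      Re (pathfinish (g p)) > B \<and> path_image (g p) \<inter> range L = {}"
    by metis
  have "bounded (\<Union>p\<in>Q. path_image (g p))"
    using Q g by (intro bounded_UN ballI bounded_path_image) auto
  then obtain N0 where N0: "\<And>p z. p \<in> Q \<Longrightarrow> z \<in> path_image (g p) \<Longrightarrow> norm z \<le> N0"
    unfolding bounded_iff by blast
  \<comment> \<open>\<open>N0\<close> bounds all escape paths; the 1 puts the horizontal segments
    where \<open>decay\<close> applies.\<close>
  define N where "N = max 1 N0"
  have N: "\<exists>g. path g \<and> pathstart g = p \<and> Re (pathfinish g) > B \<and>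
             path_image g \<inter> range L = {} \<and> (\<forall>z\<in>path_image g. norm z \<le> N)"
    if "p \<in> P" "Re p \<le> B" for p
  proof -
    have p: "p \<in> Q" using that by (simp add: Q_def)
    show ?thesis using g[OF p] N0[OF p] unfolding N_def by (intro exI[of _ "g p"]) (simp add: le_max_iff_disj)
  qed
  have NQ: "norm p \<le> N" if "p \<in> Q" for p
    using g[OF that] N0[OF that, of p] pathstart_in_path_image[of "g p"] by (simp add: N_def le_max_iff_disj)
  have B0: "B \<ge> 0" using B[of 0] by linarith
  have imL: "filterlim (\<lambda>t. Im (L t)) at_bot at_bot" "filterlim (\<lambda>t. Im (L t)) at_top at_top"
    using L by (simp_all add: vertical_contour_def)
  define a where "a = (\<lambda>n. - real n)"
  define b where "b = (\<lambda>n. real n)"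
  have ab: "filterlim a at_bot sequentially" "filterlim b at_top sequentially"
    unfolding a_def b_def
    by (auto simp: filterlim_real_sequentially filterlim_uminus_at_top[symmetric] filterlim_uminus_at_bot)
  have La: "filterlim (\<lambda>n. Im (L (a n))) at_bot sequentially"
    by (rule filterlim_compose[OF imL(1) ab(1)])
  have Lb: "filterlim (\<lambda>n. Im (L (b n))) at_top sequentially"
    by (rule filterlim_compose[OF imL(2) ab(2)])
  have "I = \<i> * (LBINT t. f (Complex c t))" if c: "c < min (- B) (- N)" for c
  proof -
    \<comment> \<open>A pole with Re \<le> B is the start of an escape path, hence has norm at most
      \<open>N\<close> and real part above c.\<close>
    have cP: "Re p \<noteq> c" if p: "p \<in> P" for p
      using c NQ[of p] abs_Re_le_cmod[of p] p B0 by (cases "Re p \<le> B") (auto simp: Q_def)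
    have line: "((\<lambda>t. f (Complex c t)) has_integral (LBINT t. f (Complex c t))) UNIV"
      by (rule has_integral_integral_lborel[OF integrable_vertical_line[OF cP]])
    from decay[of c B] obtain C where
      C: "\<And>s. c \<le> Re s \<Longrightarrow> Re s \<le> B \<Longrightarrow> 1 \<le> \<bar>Im s\<bar> \<Longrightarrow> norm (f s) \<le> C / (Im s)\<^sup>2" by blast
    define J where "J = (\<lambda>n. integral {a n..b n} (\<lambda>t. f (L t) * vector_derivative L (at t)))"
    define V where "V = (\<lambda>n. integral {Im (L (a n))..Im (L (b n))} (\<lambda>t. f (Complex c t)))"
    \<comment> \<open>The lower of the two end heights. It tends to infinity although the ends may
      rise at different rates, so both horizontal segments contribute O(1 / y^2).\<close>
    define y where "y = (\<lambda>n. min \<bar>Im (L (a n))\<bar> \<bar>Im (L (b n))\<bar>)"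
    have J: "J \<longlonglongrightarrow> I" unfolding J_def by (rule tendsto_integral_Icc_UNIV[OF I ab])
    have V: "V \<longlonglongrightarrow> (LBINT t. f (Complex c t))"
      unfolding V_def by (rule tendsto_integral_Icc_UNIV[OF line La Lb])
    have evs: "eventually (\<lambda>n. n > 0 \<and> Im (L (a n)) < - N \<and> Im (L (b n)) > N) sequentially"
      using La Lb eventually_gt_at_top[of "0::nat"]
      unfolding filterlim_at_bot_dense filterlim_at_top_dense by (intro eventually_conj) auto
    have y: "filterlim y at_top sequentially"
      unfolding filterlim_at_top
    proof
      fix Z :: real
      have "eventually (\<lambda>n. Im (L (a n)) \<le> - Z) sequentially" using La by (simp add: filterlim_at_bot)
      moreover have "eventually (\<lambda>n. Im (L (b n)) \<ge> Z) sequentially" using Lb by (simp add: filterlim_at_top)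
      ultimately show "eventually (\<lambda>n. Z \<le> y n) sequentially"
        by eventually_elim (auto simp: y_def)
    qed
    have bound: "eventually (\<lambda>n. norm (J n - \<i> * V n) \<le> 2 * (\<bar>C\<bar> / (y n)\<^sup>2) * (B - c)) sequentially"
      using evs
    proof eventually_elim
      case (elim n)
      have y1: "y n \<ge> 1" using elim by (auto simp: y_def N_def)
      show ?case unfolding J_def V_def
      proof (rule closed_truncation[OF L P B N])
        show "((\<lambda>t. f (L t) * vector_derivative L (at t)) has_integral
           integral {a n..b n} (\<lambda>t. f (L t) * vector_derivative L (at t))) {a n..b n}"
          using I by (intro integrable_integral integrable_on_subinterval[of _ UNIV]) auto
        show "norm (f s) \<le> \<bar>C\<bar> / (y n)\<^sup>2"
          if s: "c \<le> Re s" "Re s \<le> B" "\<bar>Im s\<bar> \<ge> min \<bar>Im (L (a n))\<bar> \<bar>Im (L (b n))\<bar>" for s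
        proof -
          have ys: "y n \<le> \<bar>Im s\<bar>" using s(3) by (simp add: y_def)
          have "norm (f s) \<le> C / (Im s)\<^sup>2" by (rule C) (use s ys y1 in auto)
          also have "\<dots> \<le> \<bar>C\<bar> / (Im s)\<^sup>2" by (intro divide_right_mono) auto
          also have "\<dots> \<le> \<bar>C\<bar> / (y n)\<^sup>2"
            using power_mono[OF ys, of 2] y1 ys by (intro divide_left_mono) (auto intro!: mult_pos_pos)
          finally show ?thesis .
        qed
      qed (use c elim in \<open>auto simp: N_def a_def b_def\<close>)
    qed
    have "(\<lambda>n. 2 * (\<bar>C\<bar> / (y n)\<^sup>2) * (B - c)) \<longlonglongrightarrow> 2 * 0 * (B - c)"
      by (intro tendsto_intros tendsto_divide_0[OF tendsto_const] filterlim_at_top_imp_at_infinity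
           filterlim_pow_at_top y) auto
    hence "(\<lambda>n. J n - \<i> * V n) \<longlonglongrightarrow> 0"
      using bound by (intro Lim_null_comparison[OF bound]) simp
    moreover have "(\<lambda>n. J n - \<i> * V n) \<longlonglongrightarrow> I - \<i> * (LBINT t. f (Complex c t))"
      by (intro tendsto_intros J V)
    ultimately show ?thesis using LIMSEQ_unique by fastforce
  qed
  thus ?thesis by (rule that)
qed

end

section \<open>The Meijer G-function with \<open>p = n = 0\<close> and \<open>m = q\<close>\<close>

lemma norm_Gamma_le:
  assumes "Re z > 0" shows "norm (Gamma z) \<le> Gamma (Re z)"
proof -
  let ?f = "\<lambda>t::real. complex_of_real t powr (z - 1) / of_real (exp t)"
  let ?g = "\<lambda>t::real. t powr (Re z - 1) / exp t"
  have f: "(?f has_integral Gamma z) {0..}" by (rule Gamma_integral_complex[OF assms])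
  have g: "(?g has_integral Gamma (Re z)) {0..}" by (rule Gamma_integral_real[OF assms])
  have "norm (integral {0..} ?f) \<le> integral {0..} ?g"
  proof (rule integral_norm_bound_integral)
    show "?f integrable_on {0..}" "?g integrable_on {0..}" using f g by (auto simp: integrable_on_def)
    show "norm (?f t) \<le> ?g t" if "t \<in> {0..}" for t
      using that by (cases "t = 0") (auto simp: norm_divide norm_powr_real_powr)
  qed
  thus ?thesis using f g by (simp add: integral_unique)
qed

text \<open>Each of the n factors z + i, with i a natural number, has the imaginary part of
  z.\<close>

lemma norm_pochhammer_ge: "\<bar>Im z\<bar> ^ n \<le> norm (pochhammer z n)"
proof -
  have "(\<Prod>i<n. \<bar>Im z\<bar>) \<le> (\<Prod>i<n. norm (z + of_nat i))"
  proof (rule prod_mono)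
    fix i show "0 \<le> \<bar>Im z\<bar> \<and> \<bar>Im z\<bar> \<le> norm (z + of_nat i)"
      using abs_Im_le_cmod[of "z + of_nat i"] by simp
  qed
  thus ?thesis by (simp add: pochhammer_prod prod_norm atLeast0LessThan)
qed

text \<open>The recurrence \<open>\<Gamma>(z) = \<Gamma>(z + k) / (z (z + 1) \<cdots> (z + k - 1))\<close> replaces Stirling's formula here.\<close>

lemma Gamma_vertical_decay:
  "\<exists>C\<ge>0. \<forall>z. A \<le> Re z \<and> Re z \<le> B \<and> 1 \<le> \<bar>Im z\<bar> \<longrightarrow> norm (Gamma z) \<le> C / \<bar>Im z\<bar> ^ n"
proof -
  \<comment> \<open>n factors of the Pochhammer symbol yield the desired power; the others move Re z
    + k to at least 1, where Gamma is bounded on a compact interval.\<close>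
  define k where "k = n + nat \<lceil>1 - A\<rceil>"
  have k: "A + real k \<ge> 1" unfolding k_def by linarith
  have "compact (Gamma ` {A + real k..B + real k})"
    using k by (intro compact_continuous_image continuous_on_Gamma) (auto elim!: nonpos_Ints_cases)
  hence "bounded (Gamma ` {A + real k..B + real k})" by (rule compact_imp_bounded)
  then obtain M where M: "\<forall>y\<in>Gamma ` {A + real k..B + real k}. norm y \<le> M"
    unfolding bounded_iff by blast
  show ?thesis
  proof (intro exI conjI allI impI; (elim conjE)?)
    show "\<bar>M\<bar> \<ge> 0" by simp
    fix z assume z: "A \<le> Re z" "Re z \<le> B" "1 \<le> \<bar>Im z\<bar>"
    have "z \<notin> \<int>\<^sub>\<le>\<^sub>0" "z + of_nat k \<notin> \<int>\<^sub>\<le>\<^sub>0"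
      using z(3) complex_nonpos_Reals_iff nonpos_Ints_subset_nonpos_Reals by force+
    hence eq: "Gamma z = Gamma (z + of_nat k) / pochhammer z k"
      by (subst pochhammer_Gamma) (auto simp: Gamma_eq_zero_iff)
    have "norm (Gamma (z + of_nat k)) \<le> Gamma (Re z + real k)"
      using norm_Gamma_le[of "z + of_nat k"] z k by simp
    also have "\<dots> \<le> \<bar>M\<bar>" using M[THEN bspec, of "Gamma (Re z + real k)"] z by (auto simp: abs_le_iff)
    finally have 1: "norm (Gamma (z + of_nat k)) \<le> \<bar>M\<bar>" .
    have "\<bar>Im z\<bar> ^ n \<le> \<bar>Im z\<bar> ^ k" by (rule power_increasing) (use z in \<open>auto simp: k_def\<close>)
    also have "\<dots> \<le> norm (pochhammer z k)" by (rule norm_pochhammer_ge)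
    finally have 2: "\<bar>Im z\<bar> ^ n \<le> norm (pochhammer z k)" .
    have "0 < \<bar>Im z\<bar> ^ n" using z by (intro zero_less_power) auto
    thus "norm (Gamma z) \<le> \<bar>M\<bar> / \<bar>Im z\<bar> ^ n"
      unfolding eq norm_divide using 1 2 by (intro frac_le) auto
  qed
qed

lemma prod_Gamma_vertical_decay:
  "\<exists>C\<ge>0. \<forall>s. A \<le> Re s \<and> Re s \<le> B \<and> 1 \<le> \<bar>Im s\<bar> \<longrightarrow>
     norm (\<Prod>b\<leftarrow>bs. Gamma (complex_of_real b - s)) \<le> C / ((Im s)\<^sup>2) ^ length bs"
proof (induction bs)
  case Nil
  show ?case by (intro exI[of _ 1]) auto
next
  case (Cons b bs)
  then obtain C where C: "C \<ge> 0" "\<And>s. A \<le> Re s \<Longrightarrow> Re s \<le> B \<Longrightarrow> 1 \<le> \<bar>Im s\<bar> \<Longrightarrow>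
     norm (\<Prod>b\<leftarrow>bs. Gamma (complex_of_real b - s)) \<le> C / ((Im s)\<^sup>2) ^ length bs" by blast
  \<comment> \<open>The map s \<mapsto> b - s reverses the strip [A, B] into [b - B, b - A].\<close>
  obtain D where D: "D \<ge> 0" "\<And>z. b - B \<le> Re z \<Longrightarrow> Re z \<le> b - A \<Longrightarrow> 1 \<le> \<bar>Im z\<bar> \<Longrightarrow>
     norm (Gamma z) \<le> D / \<bar>Im z\<bar> ^ 2"
    using Gamma_vertical_decay[of "b - B" "b - A" 2] by blast
  show ?case
  proof (intro exI conjI allI impI; (elim conjE)?)
    show "D * C \<ge> 0" using C D by simp
    fix s assume s: "A \<le> Re s" "Re s \<le> B" "1 \<le> \<bar>Im s\<bar>"
    have "norm (Gamma (complex_of_real b - s)) \<le> D / (Im s)\<^sup>2"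
      using D(2)[of "complex_of_real b - s"] s by simp
    hence "norm (Gamma (complex_of_real b - s)) * norm (\<Prod>b\<leftarrow>bs. Gamma (complex_of_real b - s))
        \<le> (D / (Im s)\<^sup>2) * (C / ((Im s)\<^sup>2) ^ length bs)"
      using C(2)[OF s] D(1) by (intro mult_mono) auto
    thus "norm (\<Prod>b\<leftarrow>b # bs. Gamma (complex_of_real b - s)) \<le> D * C / ((Im s)\<^sup>2) ^ length (b # bs)"
      by (simp add: norm_mult)
  qed
qed

lemma holomorphic_on_prod_list [holomorphic_intros]:
  assumes "\<And>b. b \<in> set bs \<Longrightarrow> f b holomorphic_on A"
  shows "(\<lambda>s. \<Prod>b\<leftarrow>bs. f b s) holomorphic_on A"
  using assms by (induction bs) (auto intro!: holomorphic_intros)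

text \<open>One Gamma factor already decays quadratically, whence \<open>bs\<close> must be
  nonempty; the power of x is bounded in each strip. The poles are the points b + n, which run to
  the right.\<close>

lemma contour_integrand_prod_Gamma:
  assumes "bs \<noteq> []" "x > 0"
  shows "contour_integrand (\<lambda>s. (\<Prod>b\<leftarrow>bs. Gamma (complex_of_real b - s)) * complex_of_real x powr s)
           {s. \<exists>b\<in>set bs. complex_of_real b - s \<in> \<int>\<^sub>\<le>\<^sub>0}"
proof
  have eq: "{s. \<exists>b\<in>set bs. complex_of_real b - s \<in> \<int>\<^sub>\<le>\<^sub>0}
      = (\<Union>b\<in>set bs. (\<lambda>s. complex_of_real b - s) -` \<int>\<^sub>\<le>\<^sub>0)" by auto
  show "closed {s. \<exists>b\<in>set bs. complex_of_real b - s \<in> \<int>\<^sub>\<le>\<^sub>0}"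
    unfolding eq by (intro closed_UN ballI closed_vimage closed_nonpos_Ints continuous_intros) auto
  show "finite {p \<in> {s. \<exists>b\<in>set bs. complex_of_real b - s \<in> \<int>\<^sub>\<le>\<^sub>0}. Re p \<le> R}" for R
  proof (rule finite_subset)
    show "{p \<in> {s. \<exists>b\<in>set bs. complex_of_real b - s \<in> \<int>\<^sub>\<le>\<^sub>0}. Re p \<le> R}
        \<subseteq> (\<Union>b\<in>set bs. (\<lambda>n. complex_of_real b + of_nat n) ` {..nat \<lceil>R - b\<rceil>})"
    proof clarsimp
      fix p b assume b: "b \<in> set bs" "complex_of_real b - p \<in> \<int>\<^sub>\<le>\<^sub>0" "Re p \<le> R"
      then obtain n where "complex_of_real b - p = - of_nat n" by (auto elim!: nonpos_Ints_cases')
      hence p: "p = complex_of_real b + of_nat n" by (simp add: algebra_simps)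
      have "n \<le> nat \<lceil>R - b\<rceil>" using b(3) unfolding p by simp linarith
      with b p show "\<exists>b\<in>set bs. p \<in> (\<lambda>n. complex_of_real b + of_nat n) ` {..nat \<lceil>R - b\<rceil>}" by auto
    qed
  qed auto
  show "(\<lambda>s. (\<Prod>b\<leftarrow>bs. Gamma (complex_of_real b - s)) * complex_of_real x powr s)
      holomorphic_on - {s. \<exists>b\<in>set bs. complex_of_real b - s \<in> \<int>\<^sub>\<le>\<^sub>0}"
    using assms(2) by (intro holomorphic_intros) auto
  fix A B
  obtain C where C: "C \<ge> 0" "\<And>s. A \<le> Re s \<Longrightarrow> Re s \<le> B \<Longrightarrow> 1 \<le> \<bar>Im s\<bar> \<Longrightarrow>
     norm (\<Prod>b\<leftarrow>bs. Gamma (complex_of_real b - s)) \<le> C / ((Im s)\<^sup>2) ^ length bs"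
    using prod_Gamma_vertical_decay[of A B bs] by blast
  show "\<exists>C. \<forall>s. A \<le> Re s \<and> Re s \<le> B \<and> 1 \<le> \<bar>Im s\<bar> \<longrightarrow>
     norm ((\<Prod>b\<leftarrow>bs. Gamma (complex_of_real b - s)) * complex_of_real x powr s) \<le> C / (Im s)\<^sup>2"
  proof (intro exI allI impI; elim conjE)
    fix s assume s: "A \<le> Re s" "Re s \<le> B" "1 \<le> \<bar>Im s\<bar>"
    have i1: "1 \<le> (Im s)\<^sup>2" using power_mono[OF s(3), of 2] by simp
    hence "((Im s)\<^sup>2) ^ 1 \<le> ((Im s)\<^sup>2) ^ length bs"
      using assms(1) by (intro power_increasing) (auto simp: Suc_le_eq)
    hence "C / ((Im s)\<^sup>2) ^ length bs \<le> C / (Im s)\<^sup>2"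
      using C(1) i1 by (intro divide_left_mono) (auto intro!: mult_pos_pos)
    hence 1: "norm (\<Prod>b\<leftarrow>bs. Gamma (complex_of_real b - s)) \<le> C / (Im s)\<^sup>2"
      using C(2)[OF s] by linarith
    \<comment> \<open>The sum covers both monotonicities of r \<mapsto> x^r, for x \<ge> 1 and for x
      < 1.\<close>
    have "x powr Re s \<le> x powr A + x powr B"
    proof (cases "x \<ge> 1")
      case True thus ?thesis using powr_mono[OF s(2), of x] by (simp add: add_increasing)
    next
      case False thus ?thesis using powr_mono'[OF s(1), of x] assms(2) by (simp add: add_increasing2)
    qed
    hence 2: "norm (complex_of_real x powr s) \<le> x powr A + x powr B"
      using assms(2) by (simp add: norm_powr_real_powr)
    show "norm ((\<Prod>b\<leftarrow>bs. Gamma (complex_of_real b - s)) * complex_of_real x powr s)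
        \<le> (C * (x powr A + x powr B)) / (Im s)\<^sup>2"
      unfolding norm_mult using mult_mono[OF 1 2] C(1) i1 by simp
  qed
qed

section \<open>Vertical lines as contours, and independence of the contour\<close>

lemma vertical_line_C1: "(\<lambda>t. Complex c t) C1_differentiable_on A"
  unfolding C1_differentiable_on_def
  by (intro exI[of _ "\<lambda>_. \<i>"])
     (auto simp: has_vector_derivative_complex_iff intro!: derivative_eq_intros)

lemma vertical_contour_line: "vertical_contour (\<lambda>t. Complex c t)"
  unfolding vertical_contour_def
  by (auto simp: inj_def bounded_iff filterlim_ident intro!: C1_differentiable_imp_piecewise vertical_line_C1)

text \<open>The half plane Re > c is convex, hence connected, and misses the line.\<close>

lemma right_of_vertical_line: "Re s > c \<Longrightarrow> s \<in> right_of_contour (\<lambda>t. Complex c t)"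
proof -
  assume s: "Re s > c"
  have "connected_component (- range (\<lambda>t. Complex c t)) s w" if "Re w > c" for w
  proof (rule connected_component_of_subset)
    show "connected_component {z. Re z > c} s w"
      using s that convex_connected[OF convex_halfspace_Re_gt[of c]]
      by (auto simp: connected_component_def)
  qed auto
  thus ?thesis unfolding right_of_contour_def by blast
qed

text \<open>The line through c is admissible because all poles b + n lie to its right; its
  derivative cancels the imaginary unit in 1 / (2 pi i). Uniqueness over all contours then resolves
  the definite description.\<close>

theorem meijer_G_eq_line_integral:
  fixes bs :: "real list"
  assumes bs: "bs \<noteq> []" and x: "x > 0" and c: "\<And>b. b \<in> set bs \<Longrightarrow> c < b"
  shows "meijer_G (length bs) 0 [] (map complex_of_real bs) x =
    1 / (2 * of_real pi) *
      (LBINT t. (\<Prod>b\<leftarrow>bs. Gamma (complex_of_real b - Complex c t)) * complex_of_real x powr Complex c t)"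
proof -
  define f where "f = (\<lambda>s. (\<Prod>b\<leftarrow>bs. Gamma (complex_of_real b - s)) * complex_of_real x powr s)"
  define P where "P = {s. \<exists>b\<in>set bs. complex_of_real b - s \<in> \<int>\<^sub>\<le>\<^sub>0}"
  interpret contour_integrand f P
    unfolding f_def P_def by (rule contour_integrand_prod_Gamma[OF bs x])
  have integrand: "meijer_G_integrand (length bs) 0 [] (map complex_of_real bs) x = f"
    by (simp add: fun_eq_iff meijer_G_integrand_def f_def o_def)
  have contour: "meijer_G_contour (length bs) 0 [] (map complex_of_real bs) L \<longleftrightarrow>
      vertical_contour L \<and> P \<subseteq> right_of_contour L" for L
    by (auto simp: meijer_G_contour_def P_def)
  have P: "Re p > c" if p: "p \<in> P" for p
  proof -
    from p obtain b n where b: "b \<in> set bs" "complex_of_real b - p = - of_nat n"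
      unfolding P_def by (auto elim: nonpos_Ints_cases')
    hence "p = complex_of_real b + of_nat n" by (simp add: algebra_simps)
    thus ?thesis using c[OF b(1)] by simp
  qed
  let ?L = "\<lambda>t. Complex c t"
  have L: "vertical_contour ?L" "P \<subseteq> right_of_contour ?L"
    using vertical_contour_line right_of_vertical_line P by auto
  have "((\<lambda>t. f (?L t)) has_integral (LBINT t. f (?L t))) UNIV"
    by (rule has_integral_integral_lborel[OF integrable_vertical_line]) (use P in force)
  hence "((\<lambda>t. f (?L t) * \<i>) has_integral (LBINT t. f (?L t)) * \<i>) UNIV"
    by (rule has_integral_mult_left)
  moreover have "vector_derivative ?L (at t) = \<i>" for t
    by (rule vector_derivative_at)
       (auto simp: has_vector_derivative_complex_iff intro!: derivative_eq_intros)
  ultimately have I0: "((\<lambda>t. f (?L t) * vector_derivative ?L (at t)) has_integral (LBINT t. f (?L t)) * \<i>) UNIV"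
    by simp
  \<comment> \<open>Both integrals equal the one over any line to the left of both
    thresholds.\<close>
  have uniq: "I = (LBINT t. f (?L t)) * \<i>"
    if K: "vertical_contour K" "P \<subseteq> right_of_contour K"
      "((\<lambda>t. f (K t) * vector_derivative K (at t)) has_integral I) UNIV" for K I
  proof -
    obtain c0 where "\<And>c. c < c0 \<Longrightarrow> I = \<i> * (LBINT t. f (Complex c t))"
      using contour_shift_left[OF K] by blast
    moreover obtain c1 where "\<And>c'. c' < c1 \<Longrightarrow> (LBINT t. f (?L t)) * \<i> = \<i> * (LBINT t. f (Complex c' t))"
      using contour_shift_left[OF L I0] by blast
    ultimately show ?thesis by (metis min_less_iff_conj lt_ex)
  qed
  have "has_meijer_G (length bs) 0 [] (map complex_of_real bs) x v \<longleftrightarrow>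
      v = 1 / (2 * of_real pi * \<i>) * ((LBINT t. f (?L t)) * \<i>)" for v
    unfolding has_meijer_G_def contour integrand using uniq L I0 by blast
  thus ?thesis by (simp add: meijer_G_def f_def)
qed

section \<open>Densities from integrable characteristic functions\<close>

context real_distribution
begin

text \<open>The inverse Fourier transform of the characteristic function. It is complex-valued here;
  reality is only a consequence of its representing \<open>M\<close>.\<close>

definition fourier_density :: "real \<Rightarrow> complex" where
  "fourier_density x = 1 / (2 * pi) * (CLBINT t. iexp (- (t * x)) * char M t)"

context
  assumes char_int: "integrable lborel (char M)" and no_atom: "\<And>x. measure M {x} = 0"
begin

lemma continuous_fourier_density: "continuous_on UNIV fourier_density"
proof (rule continuous_at_imp_continuous_on, rule ballI, unfold continuous_at_sequentially, intro allI impI)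
  fix x and X :: "nat \<Rightarrow> real" assume X: "X \<longlonglongrightarrow> x"
  have "(\<lambda>n. CLBINT t. iexp (- (t * X n)) * char M t) \<longlonglongrightarrow> (CLBINT t. iexp (- (t * x)) * char M t)"
  proof (rule integral_dominated_convergence[where w = "\<lambda>t. norm (char M t)"])
    show "AE t in lborel. (\<lambda>n. iexp (- (t * X n)) * char M t) \<longlonglongrightarrow> iexp (- (t * x)) * char M t"
      by (intro AE_I2 tendsto_intros X)
    show "integrable lborel (\<lambda>t. norm (char M t))" using char_int by (rule integrable_norm)
  qed (auto simp: norm_mult)
  thus "(fourier_density \<circ> X) \<longlonglongrightarrow> fourier_density x"
    unfolding o_def fourier_density_def by (intro tendsto_intros)
qed

lemma measurable_fourier_density [measurable]: "fourier_density \<in> borel_measurable borel"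
  by (rule borel_measurable_continuous_onI[OF continuous_fourier_density])

text \<open>Levy's kernel is itself the integral of exp (-itx) over x in [a, b]. Integrability of
  \<open>char M\<close> removes the truncation in Levy's formula and justifies Fubini;
  \<open>no_atom\<close> makes all a and b legitimate endpoints.\<close>

lemma measure_Ioc_fourier_density:
  assumes "a \<le> b"
  shows "complex_of_real (measure M {a<..b}) = (CLBINT x. indicator {a..b} x *\<^sub>R fourier_density x)"
proof -
  define F where "F = (\<lambda>t::real. (iexp (- (t * a)) - iexp (- (t * b))) / (\<i> * t))"
  have F_bound: "norm (F t) \<le> b - a" for t :: real
    using Levy_Inversion_aux2[of "- b" "- a" t] assms by (cases "t = 0") (auto simp: F_def)
  have F_int: "(CLBINT x. indicator {a..b} x *\<^sub>R iexp (- (t * x))) = F t" if "t \<noteq> 0" for t :: real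
  proof -
    have "((\<lambda>x. iexp (- (t * x))) has_integral
             (- iexp (- (t * b)) / (\<i> * t)) - (- iexp (- (t * a)) / (\<i> * t))) {a..b}"
    proof (rule fundamental_theorem_of_calculus[OF assms])
      fix x
      have "((\<lambda>x. (\<lambda>z. - exp (- (\<i> * of_real t * z)) / (\<i> * t)) (complex_of_real x))
          has_vector_derivative exp (- (\<i> * of_real t * of_real x))) (at x within {a..b})"
        by (rule has_vector_derivative_real_field) (use that in \<open>auto intro!: derivative_eq_intros\<close>)
      thus "((\<lambda>x. - iexp (- (t * x)) / (\<i> * t)) has_vector_derivative iexp (- (t * x))) (at x within {a..b})"
        by (simp add: mult_ac)
    qed
    moreover have "set_integrable lborel {a..b} (\<lambda>x. iexp (- (t * x)))"
      by (intro borel_integrable_atLeastAtMost' continuous_intros)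
    ultimately have "(CLBINT x:{a..b}. iexp (- (t * x))) = F t"
      by (simp add: set_borel_integral_eq_integral integral_unique diff_divide_distrib F_def)
    thus ?thesis by (simp add: set_lebesgue_integral_def)
  qed
  have F_meas [measurable]: "F \<in> borel_measurable borel" unfolding F_def by measurable
  have "(\<lambda>n. CLBINT t=-real n..real n. F t * char M t) \<longlonglongrightarrow> (CLBINT t. F t * char M t)"
  proof -
    have "(\<lambda>n. CLBINT t. indicator {-real n<..<real n} t *\<^sub>R (F t * char M t))
        \<longlonglongrightarrow> (CLBINT t. F t * char M t)"
    proof (rule integral_dominated_convergence[where w = "\<lambda>t. (b - a) * norm (char M t)"])
      show "integrable lborel (\<lambda>t. (b - a) * norm (char M t))" using char_int by auto
      show "AE t in lborel. (\<lambda>n. indicator {-real n<..<real n} t *\<^sub>R (F t * char M t)) \<longlonglongrightarrow> F t * char M t"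
      proof (rule AE_I2)
        fix t :: real
        have "eventually (\<lambda>n. \<bar>t\<bar> < real n) sequentially"
          using filterlim_real_sequentially unfolding filterlim_at_top_dense by auto
        hence "eventually (\<lambda>n. indicator {-real n<..<real n} t *\<^sub>R (F t * char M t) = F t * char M t) sequentially"
        proof eventually_elim
          case (elim n)
          hence "t \<in> {-real n<..<real n}" by auto
          thus ?case by simp
        qed
        thus "(\<lambda>n. indicator {-real n<..<real n} t *\<^sub>R (F t * char M t)) \<longlonglongrightarrow> F t * char M t"
          by (rule tendsto_eventually)
      qed
      show "AE t in lborel. norm (indicator {-real n<..<real n} t *\<^sub>R (F t * char M t)) \<le> (b - a) * norm (char M t)" for n
        using F_bound assms by (intro AE_I2) (auto simp: norm_mult indicator_def intro!: mult_right_mono F_bound)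
    qed auto
    thus ?thesis by (simp add: interval_lebesgue_integral_def set_lebesgue_integral_def)
  qed
  hence lim: "(\<lambda>n. 1 / (2 * pi) * (CLBINT t=-real n..real n. F t * char M t)) \<longlonglongrightarrow>
      1 / (2 * pi) * (CLBINT t. F t * char M t)" by (intro tendsto_intros)
  have "(\<lambda>n. 1 / (2 * pi) * (CLBINT t=-real n..real n. F t * char M t)) \<longlonglongrightarrow> complex_of_real (measure M {a<..b})"
    using Levy_Inversion[OF assms no_atom no_atom]
    by (simp only: F_def of_int_minus of_int_of_nat_eq)
  from this lim
  have "complex_of_real (measure M {a<..b}) = 1 / (2 * pi) * (CLBINT t. F t * char M t)"
    by (rule LIMSEQ_unique)
  also have "(CLBINT t. F t * char M t)
      = (CLBINT t. CLBINT x. indicator {a..b} x *\<^sub>R (iexp (- (t * x)) * char M t))"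
  proof (rule integral_cong_AE)
    \<comment> \<open>At t = 0 division by zero makes \<open>F\<close> vanish, while the inner
      integral of exp (-itx) is b - a; the single point is null.\<close>
    have "AE t in lborel. t \<noteq> (0::real)" by (rule AE_lborel_singleton)
    thus "AE t in lborel. F t * char M t = (CLBINT x. indicator {a..b} x *\<^sub>R (iexp (- (t * x)) * char M t))"
    proof eventually_elim
      case (elim t)
      have "(CLBINT x. indicator {a..b} x *\<^sub>R (iexp (- (t * x)) * char M t))
          = (CLBINT x. (indicator {a..b} x *\<^sub>R iexp (- (t * x))) * char M t)" by simp
      also have "\<dots> = F t * char M t" by (subst integral_mult_left_zero) (simp only: F_int[OF elim])
      finally show ?case by simp
    qed
  qed measurable
  also have "\<dots> = (CLBINT x. CLBINT t. indicator {a..b} x *\<^sub>R (iexp (- (t * x)) * char M t))"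
  proof (rule lborel_pair.Fubini_integral[symmetric])
    show "integrable (lborel \<Otimes>\<^sub>M lborel) (\<lambda>(t, x). indicator {a..b} x *\<^sub>R (iexp (- (t * x)) * char M t))"
    proof (rule lborel_pair.Fubini_integrable)
      have "(LBINT x. norm (indicator {a..b} x *\<^sub>R (iexp (- (t * x)) * char M t))) = (b - a) * norm (char M t)" for t
        using assms by (simp add: norm_mult)
      thus "integrable lborel (\<lambda>t. LBINT x. norm (case (t, x) of (t, x) \<Rightarrow> indicator {a..b} x *\<^sub>R (iexp (- (t * x)) * char M t)))"
        using char_int by simp
      show "AE t in lborel. complex_integrable lborel
            (\<lambda>x. case (t, x) of (t, x) \<Rightarrow> indicator {a..b} x *\<^sub>R (iexp (- (t * x)) * char M t))"
        using borel_integrable_atLeastAtMost'[of a b "\<lambda>x. iexp (- (t * x)) * char M t" for t]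
        by (intro AE_I2) (simp add: set_integrable_def continuous_intros)
    qed measurable
  qed
  also have "\<dots> = (CLBINT x. indicator {a..b} x *\<^sub>R (2 * pi * fourier_density x))"
    by (simp add: fourier_density_def)
  also have "1 / (2 * pi) * (CLBINT x. indicator {a..b} x *\<^sub>R (2 * pi * fourier_density x))
      = (CLBINT x. indicator {a..b} x *\<^sub>R fourier_density x)"
    by (subst integral_mult_right_zero[symmetric]) simp
  finally show ?thesis .
qed

text \<open>The mass of (x - 1, u] is a real, nondecreasing function of u, and its derivative at u =
  x is \<open>fourier_density x\<close>. The base x - 1 only makes x an interior point.\<close>

lemma fourier_density_nonneg: "Re (fourier_density x) \<ge> 0" and fourier_density_real: "Im (fourier_density x) = 0"
proof -
  let ?m = "\<lambda>u. measure M {x - 1<..u}"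
  have cont: "continuous_on {x - 1..x + 1} fourier_density"
    by (rule continuous_on_subset[OF continuous_fourier_density]) auto
  have eq: "complex_of_real (?m u) = integral {x - 1..u} fourier_density" if "u \<ge> x - 1" for u
  proof -
    have "set_integrable lborel {x - 1..u} fourier_density"
      by (intro borel_integrable_atLeastAtMost' continuous_on_subset[OF continuous_fourier_density]) auto
    thus ?thesis using measure_Ioc_fourier_density[OF that]
      by (simp add: set_borel_integral_eq_integral(2)[symmetric] set_lebesgue_integral_def)
  qed
  have "((\<lambda>u. integral {x - 1..u} fourier_density) has_vector_derivative fourier_density x) (at x within {x - 1..x + 1})"
    by (rule integral_has_vector_derivative[OF cont]) auto
  hence "((\<lambda>u. complex_of_real (?m u)) has_vector_derivative fourier_density x) (at x within {x - 1..x + 1})"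
    by (rule has_vector_derivative_transform[rotated 2]) (auto simp: eq)
  hence "((\<lambda>u. complex_of_real (?m u)) has_vector_derivative fourier_density x) (at x)"
    by (subst (asm) at_within_interior) auto
  hence d: "(?m has_real_derivative Re (fourier_density x)) (at x)"
      "((\<lambda>_. 0::real) has_real_derivative Im (fourier_density x)) (at x)"
    by (auto simp: has_vector_derivative_complex_iff)
  show "Im (fourier_density x) = 0" using DERIV_unique[OF d(2) DERIV_const] .
  show "Re (fourier_density x) \<ge> 0"
    by (rule mono_on_imp_deriv_nonneg[OF _ d(1), of UNIV])
       (auto intro!: mono_onI finite_measure_mono)
qed

theorem eq_density_fourier_density: "M = density lborel (\<lambda>x. ennreal (Re (fourier_density x)))"
proof -
  have sets_Ioc: "sets borel = sigma_sets UNIV (range (\<lambda>(a, b). {a<..b::real}))"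
    unfolding borel_sigma_sets_Ioc by (rule sets_measure_of) simp
  show ?thesis
  proof (rule measure_eqI_generator_eq[where \<Omega> = UNIV])
    fix X assume "X \<in> range (\<lambda>(a, b). {a<..b::real})"
    then obtain a b where X: "X = {a<..b}" by auto
    show "emeasure M X = emeasure (density lborel (\<lambda>x. ennreal (Re (fourier_density x)))) X"
    proof (cases "a \<le> b")
      case True
      have int: "integrable lborel (\<lambda>x. indicator {a..b} x *\<^sub>R fourier_density x)"
        using borel_integrable_atLeastAtMost'[OF continuous_on_subset[OF continuous_fourier_density], of a b]
        by (simp add: set_integrable_def)
      have "emeasure (density lborel (\<lambda>x. ennreal (Re (fourier_density x)))) X
          = (\<integral>\<^sup>+x. ennreal (Re (fourier_density x)) * indicator {a<..b} x \<partial>lborel)"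
        by (simp add: X emeasure_density)
      \<comment> \<open>Half-open and closed interval differ by the null set {a}.\<close>
      also have "\<dots> = (\<integral>\<^sup>+x. ennreal (Re (indicator {a..b} x *\<^sub>R fourier_density x)) \<partial>lborel)"
        using AE_lborel_singleton[of a]
        by (intro nn_integral_cong_AE) (auto elim!: eventually_mono split: split_indicator)
      also have "\<dots> = ennreal (LBINT x. Re (indicator {a..b} x *\<^sub>R fourier_density x))"
        by (intro nn_integral_eq_integral integrable_Re int AE_I2)
           (auto simp: fourier_density_nonneg split: split_indicator)
      also have "(LBINT x. Re (indicator {a..b} x *\<^sub>R fourier_density x)) = measure M {a<..b}"
        by (simp only: integral_Re[OF int] measure_Ioc_fourier_density[OF True, symmetric] Re_complex_of_real)
      finally show ?thesis by (simp add: X emeasure_eq_measure)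
    qed (simp add: X)
  next
    show "(\<Union>i. {- real (i::nat)<..real i}) = UNIV" by (rule UN_Ioc_eq_UNIV)
  qed (auto simp: sets_Ioc[symmetric] Int_stable_def emeasure_eq_measure)
qed

end
end

section \<open>Logarithms of symmetric random variables\<close>

text \<open>Substitution on compact intervals, then monotone exhaustion; \<open>Suc n\<close> keeps
  even the first interval nondegenerate.\<close>

lemma nn_integral_exp_substitution:
  fixes h :: "real \<Rightarrow> ennreal"
  assumes [measurable]: "h \<in> borel_measurable borel"
  shows "(\<integral>\<^sup>+x. h x * indicator {0<..} x \<partial>lborel) = (\<integral>\<^sup>+p. h (exp p) * ennreal (exp p) \<partial>lborel)"
proof -
  let ?A = "\<lambda>n. {exp (- real (Suc n))..exp (real (Suc n))}"
  let ?B = "\<lambda>n. {- real (Suc n)..real (Suc n)}"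
  have "(\<lambda>n. \<integral>\<^sup>+x. h x * indicator (?A n) x \<partial>lborel) \<longlonglongrightarrow> (\<integral>\<^sup>+x. h x * indicator {0<..} x \<partial>lborel)"
  proof (rule nn_integral_LIMSEQ)
    show "incseq (\<lambda>n x. h x * indicator (?A n) x)"
    proof (rule incseq_SucI, rule le_funI)
      fix n x
      have "x \<in> ?A (Suc n)" if "x \<in> ?A n"
      proof -
        have "exp (- real (Suc (Suc n))) \<le> exp (- real (Suc n))" "exp (real (Suc n)) \<le> exp (real (Suc (Suc n)))"
          unfolding exp_le_cancel_iff by simp_all
        with that show ?thesis unfolding atLeastAtMost_iff by linarith
      qed
      hence "indicator (?A n) x \<le> (indicator (?A (Suc n)) x :: ennreal)"
        by (rule indicator_leI)
      thus "h x * indicator (?A n) x \<le> h x * indicator (?A (Suc n)) x"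
        by (rule mult_left_mono) (rule zero_le)
    qed
    fix x :: real
    show "(\<lambda>n. h x * indicator (?A n) x) \<longlonglongrightarrow> h x * indicator {0<..} x"
    proof (cases "x > 0")
      case True
      have "eventually (\<lambda>n. real n \<ge> \<bar>ln x\<bar>) sequentially"
        using filterlim_real_sequentially by (simp add: filterlim_at_top)
      hence "eventually (\<lambda>n. h x * indicator (?A n) x = h x * indicator {0<..} x) sequentially"
      proof eventually_elim
        case (elim n)
        have "- real (Suc n) \<le> ln x" "ln x \<le> real (Suc n)" using elim by auto
        hence "exp (- real (Suc n)) \<le> exp (ln x)" "exp (ln x) \<le> exp (real (Suc n))" by simp_all
        thus ?case using True by simp
      qed
      thus ?thesis by (rule tendsto_eventually)
    next
      case False
      have "x \<notin> ?A n" for n using False exp_gt_zero[of "- real (Suc n)"] by (auto simp del: exp_gt_zero)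
      thus ?thesis using False by simp
    qed
  qed measurable
  also have "(\<lambda>n. \<integral>\<^sup>+x. h x * indicator (?A n) x \<partial>lborel)
      = (\<lambda>n. \<integral>\<^sup>+p. h (exp p) * ennreal (exp p) * indicator (?B n) p \<partial>lborel)"
    by (intro ext nn_integral_substitution_aux) (auto intro!: DERIV_exp continuous_intros)
  finally have 1: "(\<lambda>n. \<integral>\<^sup>+p. h (exp p) * ennreal (exp p) * indicator (?B n) p \<partial>lborel)
      \<longlonglongrightarrow> (\<integral>\<^sup>+x. h x * indicator {0<..} x \<partial>lborel)" .
  have "(\<lambda>n. \<integral>\<^sup>+p. h (exp p) * ennreal (exp p) * indicator (?B n) p \<partial>lborel)
      \<longlonglongrightarrow> (\<integral>\<^sup>+p. h (exp p) * ennreal (exp p) \<partial>lborel)"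
  proof (rule nn_integral_LIMSEQ)
    show "incseq (\<lambda>n p. h (exp p) * ennreal (exp p) * indicator (?B n) p)"
      by (intro incseq_SucI le_funI mult_left_mono) (auto split: split_indicator)
    fix p :: real
    have "eventually (\<lambda>n. real n \<ge> \<bar>p\<bar>) sequentially"
      using filterlim_real_sequentially by (simp add: filterlim_at_top)
    hence "eventually (\<lambda>n. h (exp p) * ennreal (exp p) * indicator (?B n) p = h (exp p) * ennreal (exp p)) sequentially"
    proof eventually_elim
      case (elim n)
      hence "p \<in> ?B n" by auto
      thus ?case by simp
    qed
    thus "(\<lambda>n. h (exp p) * ennreal (exp p) * indicator (?B n) p) \<longlonglongrightarrow> h (exp p) * ennreal (exp p)"
      by (rule tendsto_eventually)
  qed measurable
  with 1 show ?thesis by (rule LIMSEQ_unique)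
qed

text \<open>Phrasing the substitution as a push-forward of measures transfers it to Bochner
  integrals together with integrability.\<close>

lemma distr_exp_lborel:
  "distr (density lborel (\<lambda>p. ennreal (exp p))) borel exp = density lborel (indicator {0<..})"
proof (rule measure_eqI)
  fix A assume "A \<in> sets (distr (density lborel (\<lambda>p. ennreal (exp p))) borel exp)"
  hence A [measurable]: "A \<in> sets borel" by simp
  have "emeasure (distr (density lborel (\<lambda>p. ennreal (exp p))) borel exp) A
      = (\<integral>\<^sup>+x. indicator A x \<partial>distr (density lborel (\<lambda>p. ennreal (exp p))) borel exp)"
    by simp
  also have "\<dots> = (\<integral>\<^sup>+p. ennreal (exp p) * indicator A (exp p) \<partial>lborel)"
    by (subst nn_integral_distr) (simp_all add: nn_integral_density)
  also have "\<dots> = (\<integral>\<^sup>+x. indicator {0<..} x * indicator A x \<partial>lborel)"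
    using nn_integral_exp_substitution[of "indicator A"] by (simp add: mult.commute)
  also have "\<dots> = emeasure (density lborel (indicator {0<..})) A"
    by (simp add: emeasure_density)
  finally show "emeasure (distr (density lborel (\<lambda>p. ennreal (exp p))) borel exp) A = \<dots>" .
qed simp

lemma
  fixes h :: "real \<Rightarrow> complex"
  assumes h: "(\<lambda>x. indicator {0<..} x *\<^sub>R h x) \<in> borel_measurable borel"
  shows integrable_exp_substitution:
      "integrable lborel (\<lambda>x. indicator {0<..} x *\<^sub>R h x) \<longleftrightarrow> integrable lborel (\<lambda>p. exp p *\<^sub>R h (exp p))"
    and integral_exp_substitution:
      "(LBINT x. indicator {0<..} x *\<^sub>R h x) = (LBINT p. exp p *\<^sub>R h (exp p))"
proof -
  let ?h = "\<lambda>x. indicator {0<..} x *\<^sub>R h x"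
  note [measurable] = h
  have [measurable]: "(\<lambda>p. h (exp p)) \<in> borel_measurable borel"
    using measurable_compose[OF borel_measurable_exp h] by simp
  have ind: "(indicator {0<..} :: real \<Rightarrow> ennreal) = (\<lambda>x. ennreal (indicator {0<..} x))"
    by (auto simp: fun_eq_iff split: split_indicator)
  have hh: "(\<lambda>x. indicator {0<..} x *\<^sub>R ?h x) = ?h" by (auto split: split_indicator)
  have he: "(\<lambda>p. exp p *\<^sub>R ?h (exp p)) = (\<lambda>p. exp p *\<^sub>R h (exp p))" by simp
  have "integrable lborel ?h \<longleftrightarrow> integrable (density lborel (indicator {0<..})) ?h"
    unfolding ind by (subst integrable_density) (simp_all only: hh, auto)
  also have "\<dots> \<longleftrightarrow> integrable (density lborel (\<lambda>p. ennreal (exp p))) (\<lambda>p. ?h (exp p))"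
    unfolding distr_exp_lborel[symmetric] by (subst integrable_distr_eq) auto
  also have "\<dots> \<longleftrightarrow> integrable lborel (\<lambda>p. exp p *\<^sub>R ?h (exp p))"
    by (subst integrable_density) auto
  finally show "integrable lborel ?h \<longleftrightarrow> integrable lborel (\<lambda>p. exp p *\<^sub>R h (exp p))" unfolding he .
  have "(LBINT x. ?h x) = (\<integral>x. ?h x \<partial>density lborel (indicator {0<..}))"
    unfolding ind by (subst integral_density) (simp_all only: hh, auto)
  also have "\<dots> = (\<integral>p. ?h (exp p) \<partial>density lborel (\<lambda>p. ennreal (exp p)))"
    unfolding distr_exp_lborel[symmetric] by (subst integral_distr) auto
  also have "\<dots> = (LBINT p. exp p *\<^sub>R ?h (exp p))"
    by (subst integral_density) auto
  finally show "(LBINT x. ?h x) = (LBINT p. exp p *\<^sub>R h (exp p))" unfolding he .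
qed

lemma nn_integral_reflect:
  fixes h :: "real \<Rightarrow> ennreal"
  assumes "h \<in> borel_measurable borel"
  shows "(\<integral>\<^sup>+x. h (- x) \<partial>lborel) = (\<integral>\<^sup>+x. h x \<partial>lborel)"
  using nn_integral_real_affine[OF assms, of "-1" 0] by simp

lemma nn_integral_even:
  fixes h :: "real \<Rightarrow> ennreal"
  assumes [measurable]: "h \<in> borel_measurable borel" and even: "\<And>x. h (- x) = h x"
  shows "(\<integral>\<^sup>+x. h x \<partial>lborel) = 2 * (\<integral>\<^sup>+x. h x * indicator {0<..} x \<partial>lborel)"
proof -
  have "(\<integral>\<^sup>+x. h x \<partial>lborel) = (\<integral>\<^sup>+x. h x * indicator {0<..} x + h x * indicator {..<0} x \<partial>lborel)"
    using AE_lborel_singleton[of "0::real"]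
    by (intro nn_integral_cong_AE) (auto elim!: eventually_mono split: split_indicator)
  also have "\<dots> = (\<integral>\<^sup>+x. h x * indicator {0<..} x \<partial>lborel) + (\<integral>\<^sup>+x. h x * indicator {..<0} x \<partial>lborel)"
    by (rule nn_integral_add) measurable
  also have "(\<integral>\<^sup>+x. h x * indicator {..<0} x \<partial>lborel) = (\<integral>\<^sup>+x. h (- x) * indicator {..<0} (- x) \<partial>lborel)"
    by (rule nn_integral_reflect[symmetric]) measurable
  also have "(\<lambda>x. h (- x) * indicator {..<0} (- x)) = (\<lambda>x. h x * indicator {0<..} x)"
    by (auto simp: even split: split_indicator)
  finally show ?thesis by (simp add: mult_2)
qed

text \<open>The factor 2 counts the two signs of X, and exp p is the Jacobian of x = exp p.\<close>

lemma distributed_ln_abs: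
  fixes X :: "'a \<Rightarrow> real"
  assumes X: "distributed M lborel X f" and even: "\<And>x. f (- x) = f x"
  shows "distributed M lborel (\<lambda>\<omega>. ln \<bar>X \<omega>\<bar>) (\<lambda>p. 2 * f (exp p) * ennreal (exp p))"
  unfolding distributed_def
proof safe
  have [measurable]: "f \<in> borel_measurable borel" using distributed_borel_measurable[OF X] by simp
  have [measurable]: "X \<in> borel_measurable M" using distributed_measurable[OF X] by simp
  show "(\<lambda>p. 2 * f (exp p) * ennreal (exp p)) \<in> borel_measurable lborel" by measurable
  show meas: "(\<lambda>\<omega>. ln \<bar>X \<omega>\<bar>) \<in> measurable M lborel" by measurable
  show "distr M lborel (\<lambda>\<omega>. ln \<bar>X \<omega>\<bar>) = density lborel (\<lambda>p. 2 * f (exp p) * ennreal (exp p))"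
  proof (rule measure_eqI)
    fix A assume "A \<in> sets (distr M lborel (\<lambda>\<omega>. ln \<bar>X \<omega>\<bar>))"
    hence [measurable]: "A \<in> sets borel" by simp
    have "emeasure (distr M lborel (\<lambda>\<omega>. ln \<bar>X \<omega>\<bar>)) A = (\<integral>\<^sup>+\<omega>. indicator A (ln \<bar>X \<omega>\<bar>) \<partial>M)"
      using nn_integral_distr[OF meas, of "indicator A"] by simp
    also have "\<dots> = (\<integral>\<^sup>+x. f x * indicator A (ln \<bar>x\<bar>) \<partial>lborel)"
      by (rule distributed_nn_integral[OF X, symmetric]) measurable
    also have "\<dots> = 2 * (\<integral>\<^sup>+x. f x * indicator A (ln \<bar>x\<bar>) * indicator {0<..} x \<partial>lborel)"
      by (rule nn_integral_even) (auto simp: even)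
    also have "\<dots> = 2 * (\<integral>\<^sup>+p. f (exp p) * indicator A (ln \<bar>exp p\<bar>) * ennreal (exp p) \<partial>lborel)"
      by (subst nn_integral_exp_substitution) auto
    also have "\<dots> = (\<integral>\<^sup>+p. 2 * f (exp p) * ennreal (exp p) * indicator A p \<partial>lborel)"
      by (subst nn_integral_cmult[symmetric]) (auto simp: mult_ac)
    also have "\<dots> = emeasure (density lborel (\<lambda>p. 2 * f (exp p) * ennreal (exp p))) A"
      by (simp add: emeasure_density)
    finally show "emeasure (distr M lborel (\<lambda>\<omega>. ln \<bar>X \<omega>\<bar>)) A = \<dots>" .
  qed simp
qed

text \<open>A symmetric law is determined by that of the absolute value. In the density, 1 / |z| is
  the Jacobian of the logarithm and 1/2 splits the mass between the signs.\<close>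

lemma distributed_of_ln_abs:
  fixes Z :: "'a \<Rightarrow> real"
  assumes [measurable]: "Z \<in> borel_measurable M"
    and nz: "AE \<omega> in M. Z \<omega> \<noteq> 0"
    and sym: "distr M borel (\<lambda>\<omega>. - Z \<omega>) = distr M borel Z"
    and g: "distributed M lborel (\<lambda>\<omega>. ln \<bar>Z \<omega>\<bar>) g"
  shows "distributed M lborel Z (\<lambda>z. g (ln \<bar>z\<bar>) * ennreal (1 / (2 * \<bar>z\<bar>)))"
  unfolding distributed_def
proof safe
  have [measurable]: "g \<in> borel_measurable borel" using distributed_borel_measurable[OF g] by simp
  define k where "k = (\<lambda>z. g (ln \<bar>z\<bar>) * ennreal (1 / (2 * \<bar>z\<bar>)))"
  have [measurable]: "k \<in> borel_measurable borel" unfolding k_def by measurable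
  have k_even: "k (- z) = k z" for z by (simp add: k_def)
  show "k \<in> borel_measurable lborel" by measurable
  show "Z \<in> measurable M lborel" by measurable
  show "distr M lborel Z = density lborel k"
  proof (rule measure_eqI)
    fix A assume "A \<in> sets (distr M lborel Z)"
    hence [measurable]: "A \<in> sets borel" by simp
    \<comment> \<open>Adding the events Z in A and -Z in A, equally likely by symmetry, gives an
      even function of Z, hence one of |Z|.\<close>
    define H where "H = (\<lambda>x::real. indicator A x + indicator A (- x) :: ennreal)"
    have [measurable]: "H \<in> borel_measurable borel" unfolding H_def by measurable
    have N: "emeasure (distr M lborel Z) A = (\<integral>\<^sup>+\<omega>. indicator A (Z \<omega>) \<partial>M)"
      using nn_integral_distr[of Z M lborel "indicator A"] by simp
    have N': "emeasure (distr M lborel Z) A = (\<integral>\<^sup>+\<omega>. indicator A (- Z \<omega>) \<partial>M)"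
    proof -
      have "emeasure (distr M lborel Z) A = emeasure (distr M borel (\<lambda>\<omega>. - Z \<omega>)) A"
        unfolding sym by (simp add: emeasure_distr)
      thus ?thesis using nn_integral_distr[of "\<lambda>\<omega>. - Z \<omega>" M borel "indicator A"] by simp
    qed
    have "2 * emeasure (distr M lborel Z) A = (\<integral>\<^sup>+\<omega>. indicator A (Z \<omega>) \<partial>M) + (\<integral>\<^sup>+\<omega>. indicator A (- Z \<omega>) \<partial>M)"
      using N N' by (simp add: mult_2)
    also have "\<dots> = (\<integral>\<^sup>+\<omega>. H (Z \<omega>) \<partial>M)"
      unfolding H_def by (rule nn_integral_add[symmetric]) measurable
    \<comment> \<open>\<open>nz\<close> enters here: exp (ln |z|) = |z| fails at z = 0.\<close>
    also have "\<dots> = (\<integral>\<^sup>+\<omega>. H (exp (ln \<bar>Z \<omega>\<bar>)) \<partial>M)"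
      using nz by (intro nn_integral_cong_AE) (auto elim!: eventually_mono simp: H_def abs_if add.commute)
    also have "\<dots> = (\<integral>\<^sup>+p. g p * H (exp p) \<partial>lborel)"
      by (rule distributed_nn_integral[OF g, symmetric]) measurable
    also have "\<dots> = (\<integral>\<^sup>+p. 2 * k (exp p) * H (exp p) * ennreal (exp p) \<partial>lborel)"
    proof (rule nn_integral_cong)
      fix p
      have "ennreal 2 * (ennreal (1 / (2 * exp p)) * ennreal (exp p)) = ennreal (2 * (1 / (2 * exp p) * exp p))"
        by (subst ennreal_mult'[symmetric], simp, subst ennreal_mult'[symmetric]) simp_all
      hence "2 * (ennreal (1 / (2 * exp p)) * ennreal (exp p)) = 1" by simp
      thus "g p * H (exp p) = 2 * k (exp p) * H (exp p) * ennreal (exp p)"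
        by (simp add: k_def mult_ac) (metis mult.assoc mult.commute mult_1)
    qed
    also have "\<dots> = (\<integral>\<^sup>+x. 2 * k x * H x * indicator {0<..} x \<partial>lborel)"
      by (rule nn_integral_exp_substitution[symmetric]) measurable
    also have "\<dots> = 2 * (\<integral>\<^sup>+x. k x * H x * indicator {0<..} x \<partial>lborel)"
      by (subst nn_integral_cmult[symmetric]) (auto simp: mult_ac)
    also have "\<dots> = (\<integral>\<^sup>+x. k x * H x \<partial>lborel)"
      by (rule nn_integral_even[symmetric]) (auto simp: k_even H_def add.commute)
    also have "\<dots> = (\<integral>\<^sup>+x. k x * indicator A x \<partial>lborel) + (\<integral>\<^sup>+x. k (- x) * indicator A (- x) \<partial>lborel)"
      unfolding H_def distrib_left k_even by (rule nn_integral_add) measurable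
    also have "(\<integral>\<^sup>+x. k (- x) * indicator A (- x) \<partial>lborel) = (\<integral>\<^sup>+x. k x * indicator A x \<partial>lborel)"
      by (rule nn_integral_reflect) measurable
    also have "(\<integral>\<^sup>+x. k x * indicator A x \<partial>lborel) = emeasure (density lborel k) A"
      by (simp add: emeasure_density)
    finally have "2 * emeasure (distr M lborel Z) A = 2 * emeasure (density lborel k) A"
      by (simp add: mult_2)
    thus "emeasure (distr M lborel Z) A = emeasure (density lborel k) A"
      by (simp add: ennreal_mult_cancel_left)
  qed simp
qed

section \<open>The logarithmic K-distribution\<close>

lemma integral_convolution:
  fixes f g :: "real \<Rightarrow> complex"
  assumes f: "integrable lborel f" and g: "integrable lborel g"
  shows "(LBINT r. LBINT q. f (r - q) * g q) = (LBINT p. f p) * (LBINT q. g q)"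
proof -
  have [measurable]: "f \<in> borel_measurable borel" "g \<in> borel_measurable borel"
    using f g by (simp_all add: borel_measurable_integrable)
  have f': "integrable lborel (\<lambda>r. f (r - q))" for q
    using lborel_integrable_real_affine[OF f, of 1 "- q"] by simp
  have shift: "(LBINT r. h (r - q)) = (LBINT r. h r)" for q and h :: "real \<Rightarrow> 'c :: {banach, second_countable_topology}"
    using lborel_integral_real_affine[of 1 h "- q"] by simp
  have "integrable (lborel \<Otimes>\<^sub>M lborel) (\<lambda>(q, r). f (r - q) * g q)"
  proof (rule lborel_pair.Fubini_integrable)
    have "integrable lborel (\<lambda>q. (LBINT r. norm (f r)) * norm (g q))"
      using g by (intro integrable_mult_right integrable_norm)
    thus "integrable lborel (\<lambda>q. LBINT r. norm (case (q, r) of (q, r) \<Rightarrow> f (r - q) * g q))"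
      by (simp add: norm_mult shift[of "\<lambda>r. norm (f r)"])
    show "AE q in lborel. integrable lborel (\<lambda>r. case (q, r) of (q, r) \<Rightarrow> f (r - q) * g q)"
      using f' by simp
  qed measurable
  from lborel_pair.Fubini_integral[OF this]
  have "(LBINT r. LBINT q. f (r - q) * g q) = (LBINT q. LBINT r. f (r - q) * g q)" .
  also have "\<dots> = (LBINT q. (LBINT p. f p) * g q)" by (simp add: shift)
  finally show ?thesis by simp
qed

text \<open>The density of the logarithm of a Gamma variable with shape a and unit scale.\<close>

definition log_gamma_density :: "real \<Rightarrow> real \<Rightarrow> real" where
  "log_gamma_density a p = exp (a * p - exp p) / Gamma a"

lemma measurable_log_gamma_density [measurable]: "log_gamma_density a \<in> borel_measurable borel"
  unfolding log_gamma_density_def[abs_def] by measurable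

lemma log_gamma_density_nonneg: "a > 0 \<Longrightarrow> log_gamma_density a p \<ge> 0"
  by (simp add: log_gamma_density_def)

text \<open>With x = exp p this is Euler's integral for Gamma at a + it.\<close>

lemma
  assumes "a > 0"
  shows integrable_char_log_gamma_density:
      "integrable lborel (\<lambda>p. complex_of_real (log_gamma_density a p) * iexp (t * p))"
    and integral_char_log_gamma_density:
      "(LBINT p. complex_of_real (log_gamma_density a p) * iexp (t * p)) = Gamma (Complex a t) / of_real (Gamma a)"
proof -
  let ?z = "Complex a t"
  let ?h = "\<lambda>x. complex_of_real x powr (?z - 1) / of_real (exp x)"
  have z: "Re ?z > 0" using assms by simp
  have meas: "(\<lambda>x. indicator {0<..} x *\<^sub>R ?h x) \<in> borel_measurable borel"
    by (rule borel_measurable_continuous_on_indicator) (auto intro!: continuous_intros)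
  have "set_integrable lebesgue {0<..} ?h"
    using absolutely_integrable_Gamma_integral'[OF z] .
  hence int: "integrable lborel (\<lambda>x. indicator {0<..} x *\<^sub>R ?h x)"
    using meas by (simp add: set_integrable_def integrable_completion)
  have "(LBINT x:{0<..}. ?h x) = integral {0<..} ?h"
    by (rule set_borel_integral_eq_integral) (simp add: set_integrable_def int)
  also have "\<dots> = Gamma ?z" using Gamma_integral_complex'[OF z] by (rule integral_unique)
  finally have eq: "(LBINT x. indicator {0<..} x *\<^sub>R ?h x) = Gamma ?z"
    by (simp add: set_lebesgue_integral_def)
  have h: "exp p *\<^sub>R ?h (exp p) = of_real (Gamma a) * (complex_of_real (log_gamma_density a p) * iexp (t * p))" for p
  proof -
    have "complex_of_real (exp p) powr (?z - 1) = exp ((?z - 1) * of_real p)"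
      by (simp add: powr_def Ln_of_real)
    moreover have "Gamma a \<noteq> 0" using Gamma_real_pos[OF assms] by simp
    ultimately show ?thesis
      by (simp add: log_gamma_density_def scaleR_conv_of_real exp_of_real[symmetric] exp_diff exp_add[symmetric] Complex_eq algebra_simps)
         (simp add: exp_add exp_diff exp_minus field_simps)
  qed
  have nz: "complex_of_real (Gamma a) \<noteq> 0" using Gamma_real_pos[OF assms] by simp
  show "integrable lborel (\<lambda>p. complex_of_real (log_gamma_density a p) * iexp (t * p))"
    using integrable_mult_right[of "1 / of_real (Gamma a)", OF int[unfolded integrable_exp_substitution[OF meas] h]] nz
    by simp
  show "(LBINT p. complex_of_real (log_gamma_density a p) * iexp (t * p)) = Gamma ?z / of_real (Gamma a)"
    using eq nz unfolding integral_exp_substitution[OF meas] h by (simp add: field_simps)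
qed

lemma integrable_log_gamma_density:
  assumes "a > 0" shows "integrable lborel (log_gamma_density a)"
  using integrable_Re[OF integrable_char_log_gamma_density[OF assms, of 0]] by simp

text \<open>The exponent a p - exp p is largest at p = ln a; the proof is ln y \<le> y - 1 at y =
  exp p / a. Boundedness makes the convolution below converge for every r, not just almost every
  r.\<close>

lemma log_gamma_density_bounded:
  assumes "a > 0" shows "log_gamma_density a p \<le> exp (a * ln a - a) / Gamma a"
proof -
  have "ln (exp p / a) \<le> exp p / a - 1" using assms by (intro ln_le_minus_one) simp
  hence "a * (p - ln a) \<le> exp p - a" using assms by (simp add: ln_div field_simps)
  thus ?thesis using assms by (simp add: log_gamma_density_def divide_right_mono algebra_simps)
qed

text \<open>Given as a convolution, so that its Fourier transform factors; the link with
  \<open>Bessel_K\<close> is a separate identity.\<close>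

definition log_K_density :: "real \<Rightarrow> real \<Rightarrow> real \<Rightarrow> real" where
  "log_K_density a b r = (LBINT q. log_gamma_density a (r - q) * log_gamma_density b q)"

lemma measurable_log_K_density [measurable]: "log_K_density a b \<in> borel_measurable borel"
  unfolding log_K_density_def[abs_def] by measurable

lemma log_K_density_nonneg: "a > 0 \<Longrightarrow> b > 0 \<Longrightarrow> log_K_density a b r \<ge> 0"
  unfolding log_K_density_def by (intro integral_nonneg_AE AE_I2 mult_nonneg_nonneg log_gamma_density_nonneg)

text \<open>The splitting r = (r - q) + q distributes exp (itr) over the two factors, leaving a
  convolution of integrable functions.\<close>

lemma integral_char_log_K_density:
  assumes "a > 0" "b > 0"
  shows "(LBINT r. complex_of_real (log_K_density a b r) * iexp (t * r))
    = Gamma (Complex a t) * Gamma (Complex b t) / of_real (Gamma a * Gamma b)"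
proof -
  have "complex_of_real (log_K_density a b r) * iexp (t * r) =
    (LBINT q. (complex_of_real (log_gamma_density a (r - q)) * iexp (t * (r - q))) *
              (complex_of_real (log_gamma_density b q) * iexp (t * q)))" for r
  proof -
    have "complex_of_real (log_gamma_density a (r - q)) * iexp (t * (r - q)) *
              (complex_of_real (log_gamma_density b q) * iexp (t * q))
        = complex_of_real (log_gamma_density a (r - q) * log_gamma_density b q) * iexp (t * r)" for q
    proof -
      have "\<i> * complex_of_real (t * (r - q)) + \<i> * complex_of_real (t * q) = \<i> * complex_of_real (t * r)"
        by (simp add: algebra_simps)
      hence "iexp (t * (r - q)) * iexp (t * q) = iexp (t * r)" by (simp only: exp_add[symmetric])
      thus ?thesis by (simp only: of_real_mult mult.assoc mult.left_commute)
    qed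
    thus ?thesis by (simp only: integral_mult_left_zero integral_complex_of_real log_K_density_def)
  qed
  hence "(LBINT r. complex_of_real (log_K_density a b r) * iexp (t * r)) =
    (LBINT r. LBINT q. (complex_of_real (log_gamma_density a (r - q)) * iexp (t * (r - q))) *
              (complex_of_real (log_gamma_density b q) * iexp (t * q)))" by (simp only:)
  also have "\<dots> = (LBINT p. complex_of_real (log_gamma_density a p) * iexp (t * p)) *
      (LBINT q. complex_of_real (log_gamma_density b q) * iexp (t * q))"
    by (rule integral_convolution[OF integrable_char_log_gamma_density[OF assms(1)]
          integrable_char_log_gamma_density[OF assms(2)]])
  also have "\<dots> = Gamma (Complex a t) / of_real (Gamma a) * (Gamma (Complex b t) / of_real (Gamma b))"
    by (simp only: integral_char_log_gamma_density assms)
  finally show ?thesis by simp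
qed

text \<open>
  The logarithm of the product of two independent Gamma variables has a Bessel density; the
  substitution \<open>q = r / 2 - t\<close> turns the convolution into the integral defining \<open>K\<close>.
\<close>

lemma log_K_density_eq_Bessel_K:
  assumes "a > 0" "b > 0"
  shows "log_K_density a b r =
    2 * exp ((a + b) / 2 * r) / (Gamma a * Gamma b) * Bessel_K (a - b) (2 * exp (r / 2))"
proof -
  define x where "x = 2 * exp (r / 2)"
  define \<phi> where "\<phi> = (\<lambda>t. exp (- x * cosh t + (a - b) * t))"
  define k where "k = exp ((a + b) / 2 * r) / (Gamma a * Gamma b)"
  have k: "k > 0" unfolding k_def using assms by simp
  \<comment> \<open>The two inner exponentials add up to exp (r/2) (e^t + e^-t) = x cosh t, and the
    linear terms to (a + b) r / 2 + (a - b) t. The unsimplified \<open>r / 2 + -1 * t\<close> is the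
    shape that the affine substitution produces.\<close>
  have \<phi>: "log_gamma_density a (r - (r / 2 + -1 * t)) * log_gamma_density b (r / 2 + -1 * t) = k * \<phi> t" for t
  proof -
    have "2 * cosh t = exp t + exp (- t)" by (simp add: cosh_def)
    moreover have "exp (r / 2 - t) = exp (r / 2) * exp (- t)"
      using exp_add[of "r / 2" "- t"] by (simp only: add_uminus_conv_diff)
    moreover have "x * cosh t = exp (r / 2) * (2 * cosh t)" by (simp add: x_def)
    ultimately have "exp (r / 2 + t) + exp (r / 2 - t) = x * cosh t"
      by (simp only: exp_add distrib_left)
    moreover have "(a * (r / 2 + t) - e) + (b * (r / 2 - t) - e')
        = (a + b) / 2 * r + (- (e + e') + (a - b) * t)" for e e'
      by (simp add: field_simps)
    ultimately have "(a * (r / 2 + t) - exp (r / 2 + t)) + (b * (r / 2 - t) - exp (r / 2 - t))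
        = (a + b) / 2 * r + (- x * cosh t + (a - b) * t)" by simp
    hence "exp (a * (r / 2 + t) - exp (r / 2 + t)) * exp (b * (r / 2 - t) - exp (r / 2 - t))
        = exp ((a + b) / 2 * r) * \<phi> t" unfolding \<phi>_def by (simp only: exp_add[symmetric])
    moreover have "r / 2 + -1 * t = r / 2 - t" "r - (r / 2 - t) = r / 2 + t" by simp_all
    hence "log_gamma_density a (r - (r / 2 + -1 * t)) * log_gamma_density b (r / 2 + -1 * t) =
        exp (a * (r / 2 + t) - exp (r / 2 + t)) * exp (b * (r / 2 - t) - exp (r / 2 - t)) / (Gamma a * Gamma b)"
      by (simp only: log_gamma_density_def times_divide_times_eq)
    ultimately show ?thesis unfolding k_def by (simp only: times_divide_eq_left)
  qed
  have "integrable lborel (\<lambda>q. log_gamma_density a (r - q) * log_gamma_density b q)"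
  proof (rule Bochner_Integration.integrable_bound)
    show "integrable lborel (\<lambda>q. exp (a * ln a - a) / Gamma a * log_gamma_density b q)"
      by (intro integrable_mult_right integrable_log_gamma_density assms)
    show "AE q in lborel. norm (log_gamma_density a (r - q) * log_gamma_density b q)
        \<le> norm (exp (a * ln a - a) / Gamma a * log_gamma_density b q)"
    proof (rule AE_I2)
      fix q
      have "log_gamma_density a (r - q) * log_gamma_density b q \<le> exp (a * ln a - a) / Gamma a * log_gamma_density b q"
        by (intro mult_right_mono log_gamma_density_bounded log_gamma_density_nonneg assms)
      moreover have "0 \<le> log_gamma_density a (r - q) * log_gamma_density b q"
        by (intro mult_nonneg_nonneg log_gamma_density_nonneg assms)
      ultimately show "norm (log_gamma_density a (r - q) * log_gamma_density b q)
        \<le> norm (exp (a * ln a - a) / Gamma a * log_gamma_density b q)" unfolding real_norm_def by linarith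
    qed
  qed measurable
  from lborel_integrable_real_affine[OF this, of "-1" "r / 2"]
  have int: "integrable lborel \<phi>" unfolding \<phi> using k by simp
  hence [measurable]: "\<phi> \<in> borel_measurable borel" by (simp add: borel_measurable_integrable)
  have "log_K_density a b r = (LBINT t. k * \<phi> t)"
    unfolding log_K_density_def by (subst lborel_integral_real_affine[of "-1" _ "r / 2"]) (simp_all only: \<phi>, simp_all)
  also have "\<dots> = k * (LBINT t. \<phi> t)" by simp
  \<comment> \<open>Folding the line at 0 pairs t with -t: the even factor exp (-x cosh t) stays,
    and exp ((a - b) t) becomes 2 cosh ((a - b) t).\<close>
  also have "(LBINT t. \<phi> t) = (LBINT t. indicator {0..} t * \<phi> t + indicator {..<0} t * \<phi> t)"
    by (intro Bochner_Integration.integral_cong) (auto split: split_indicator)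
  also have "\<dots> = (LBINT t. indicator {0..} t * \<phi> t) + (LBINT t. indicator {..<0} t * \<phi> t)"
    using integrable_mult_indicator[OF _ int] by (intro Bochner_Integration.integral_add) auto
  also have "(LBINT t. indicator {..<0} t * \<phi> t) = (LBINT t. indicator {..<0} (- t) * \<phi> (- t))"
    using lborel_integral_real_affine[of "-1" "\<lambda>t. indicator {..<0} t * \<phi> t" 0] by simp
  also have "\<dots> = (LBINT t. indicator {0..} t * \<phi> (- t))"
    using AE_lborel_singleton[of "0::real"]
    by (intro integral_cong_AE) (measurable, auto elim!: eventually_mono split: split_indicator)
  also have "(LBINT t. indicator {0..} t * \<phi> t) + \<dots> = (LBINT t. indicator {0..} t * \<phi> t + indicator {0..} t * \<phi> (- t))"
  proof (rule Bochner_Integration.integral_add[symmetric])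
    have "integrable lborel (\<lambda>t. \<phi> (- t))" using lborel_integrable_real_affine[OF int, of "-1" 0] by simp
    from integrable_mult_indicator[OF _ this, of "{0..}"] show "integrable lborel (\<lambda>t. indicator {0..} t * \<phi> (- t))" by simp
    from integrable_mult_indicator[OF _ int, of "{0..}"] show "integrable lborel (\<lambda>t. indicator {0..} t * \<phi> t)" by simp
  qed
  also have "\<dots> = (LBINT t. 2 * (indicator {0..} t * (exp (- x * cosh t) * cosh ((a - b) * t))))"
  proof (intro Bochner_Integration.integral_cong refl)
    fix t
    have "2 * cosh ((a - b) * t) = exp ((a - b) * t) + exp ((a - b) * - t)" by (simp add: cosh_def)
    hence "\<phi> t + \<phi> (- t) = exp (- x * cosh t) * (2 * cosh ((a - b) * t))"
      unfolding \<phi>_def cosh_minus exp_add by (simp only: distrib_left[symmetric])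
    hence "indicator {0..} t * \<phi> t + indicator {0..} t * \<phi> (- t) =
        indicator {0..} t * (exp (- x * cosh t) * (2 * cosh ((a - b) * t)))"
      by (simp only: distrib_left[symmetric])
    thus "indicator {0..} t * \<phi> t + indicator {0..} t * \<phi> (- t) =
        2 * (indicator {0..} t * (exp (- x * cosh t) * cosh ((a - b) * t)))"
      by (simp only: mult_ac)
  qed
  also have "\<dots> = 2 * Bessel_K (a - b) x"
    by (simp add: Bessel_K_def set_lebesgue_integral_def)
  finally show ?thesis by (simp add: x_def k_def)
qed

text \<open>On the logarithmic scale the inverse scale \<delta> is a translation by ln \<delta>,
  absorbing both the prefactor and the Bessel argument.\<close>

lemma sym_K_density_exp:
  assumes "\<alpha> > 0" "\<zeta> > 0" "\<delta> > 0"
  shows "2 * sym_K_density \<alpha> \<zeta> \<delta> (exp p) * exp p = log_K_density \<alpha> \<zeta> (p + ln \<delta>)"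
proof -
  have s: "2 * sqrt (\<delta> * exp p) = 2 * exp ((p + ln \<delta>) / 2)"
  proof -
    have "(exp ((p + ln \<delta>) / 2))\<^sup>2 = exp (2 * ((p + ln \<delta>) / 2))" by (simp only: exp_double)
    also have "2 * ((p + ln \<delta>) / 2) = ln \<delta> + p" by simp
    also have "exp (ln \<delta> + p) = \<delta> * exp p" using assms by (simp only: exp_add exp_ln)
    finally show ?thesis by (simp add: real_sqrt_unique)
  qed
  define \<mu> where "\<mu> = (\<alpha> + \<zeta>) / 2"
  have "\<delta> powr \<mu> * exp p powr (\<mu> - 1) * exp p = exp (\<mu> * ln \<delta> + (\<mu> - 1) * p + p)"
  proof -
    have "exp p \<noteq> 0" "\<delta> \<noteq> 0" using assms by auto
    thus ?thesis unfolding powr_def ln_exp exp_add by (simp only: if_False)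
  qed
  also have "\<mu> * ln \<delta> + (\<mu> - 1) * p + p = \<mu> * (p + ln \<delta>)" by (simp add: algebra_simps)
  finally have "\<delta> powr ((\<alpha> + \<zeta>) / 2) * exp p powr ((\<alpha> + \<zeta>) / 2 - 1) * exp p = exp ((\<alpha> + \<zeta>) / 2 * (p + ln \<delta>))"
    unfolding \<mu>_def .
  thus ?thesis
    unfolding log_K_density_eq_Bessel_K[OF assms(1,2)] sym_K_density_def s[symmetric] abs_exp_cancel
    by (simp add: mult_ac)
qed

text \<open>The translation by ln \<delta> shows up in the characteristic function as the phase exp
  (-it ln \<delta>).\<close>

lemma (in prob_space)
  assumes pos: "\<alpha> > 0" "\<zeta> > 0" "\<delta> > 0"
    and X: "distributed M lborel X (\<lambda>x. ennreal (sym_K_density \<alpha> \<zeta> \<delta> x))"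
  shows distributed_ln_abs_sym_K:
      "distributed M lborel (\<lambda>\<omega>. ln \<bar>X \<omega>\<bar>) (\<lambda>p. ennreal (log_K_density \<alpha> \<zeta> (p + ln \<delta>)))"
    and char_ln_abs_sym_K:
      "char (distr M borel (\<lambda>\<omega>. ln \<bar>X \<omega>\<bar>)) t = iexp (- (t * ln \<delta>)) *
         (Gamma (Complex \<alpha> t) * Gamma (Complex \<zeta> t) / of_real (Gamma \<alpha> * Gamma \<zeta>))"
proof -
  have "2 * ennreal (sym_K_density \<alpha> \<zeta> \<delta> (exp p)) * ennreal (exp p)
      = ennreal (log_K_density \<alpha> \<zeta> (p + ln \<delta>))" for p
    unfolding sym_K_density_exp[OF pos, symmetric]
    by (simp add: ennreal_mult'' ennreal_mult')
  thus D: "distributed M lborel (\<lambda>\<omega>. ln \<bar>X \<omega>\<bar>) (\<lambda>p. ennreal (log_K_density \<alpha> \<zeta> (p + ln \<delta>)))"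
    using distributed_ln_abs[OF X] by (simp add: sym_K_density_def)
  have "distr M borel (\<lambda>\<omega>. ln \<bar>X \<omega>\<bar>) = density lborel (\<lambda>p. ennreal (log_K_density \<alpha> \<zeta> (p + ln \<delta>)))"
    using distributed_distr_eq_density[OF D] by (simp cong: distr_cong)
  hence "char (distr M borel (\<lambda>\<omega>. ln \<bar>X \<omega>\<bar>)) t =
      (LBINT p. complex_of_real (log_K_density \<alpha> \<zeta> (p + ln \<delta>)) * iexp (t * p))"
    unfolding char_def
    by (simp add: integral_density log_K_density_nonneg pos scaleR_conv_of_real)
  also have "\<dots> = (LBINT r. complex_of_real (log_K_density \<alpha> \<zeta> r) * iexp (t * (r - ln \<delta>)))"
    using lborel_integral_real_affine[of 1 "\<lambda>r. complex_of_real (log_K_density \<alpha> \<zeta> r) * iexp (t * (r - ln \<delta>))" "ln \<delta>"]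
    by (simp add: add.commute)
  also have "\<dots> = (LBINT r. iexp (- (t * ln \<delta>)) * (complex_of_real (log_K_density \<alpha> \<zeta> r) * iexp (t * r)))"
  proof (intro Bochner_Integration.integral_cong refl)
    fix r
    have "\<i> * complex_of_real (t * (r - ln \<delta>)) = \<i> * complex_of_real (- (t * ln \<delta>)) + \<i> * complex_of_real (t * r)"
      by (simp add: algebra_simps)
    thus "complex_of_real (log_K_density \<alpha> \<zeta> r) * iexp (t * (r - ln \<delta>)) =
        iexp (- (t * ln \<delta>)) * (complex_of_real (log_K_density \<alpha> \<zeta> r) * iexp (t * r))"
      by (simp only: exp_add mult.left_commute)
  qed
  also have "\<dots> = iexp (- (t * ln \<delta>)) * (Gamma (Complex \<alpha> t) * Gamma (Complex \<zeta> t) / of_real (Gamma \<alpha> * Gamma \<zeta>))"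
    by (simp only: integral_mult_right_zero integral_char_log_K_density pos)
  finally show "char (distr M borel (\<lambda>\<omega>. ln \<bar>X \<omega>\<bar>)) t = \<dots>" .
qed

section \<open>The product of two K-distributed variables\<close>

lemma (in prob_space) distr_uminus_even:
  fixes X :: "'a \<Rightarrow> real"
  assumes X: "distributed M lborel X f" and even: "\<And>x. f (- x) = f x"
  shows "distr M borel (\<lambda>\<omega>. - X \<omega>) = distr M borel X"
proof -
  have "distributed M lborel (\<lambda>\<omega>. - X \<omega>) f"
    using distributed_affine[OF X, of "-1" 0] by (simp add: even divide_ennreal_def)
  hence "distr M lborel (\<lambda>\<omega>. - X \<omega>) = distr M lborel X"
    using distributed_distr_eq_density X by metis
  thus ?thesis by (simp cong: distr_cong)
qed

text \<open>The law of a product of independent variables depends only on the two marginals, and -X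
  has the marginal of X.\<close>

lemma (in prob_space) distr_mult_uminus:
  fixes X Y :: "'a \<Rightarrow> real"
  assumes indep: "indep_var borel X borel Y"
    and sym: "distr M borel (\<lambda>\<omega>. - X \<omega>) = distr M borel X"
  shows "distr M borel (\<lambda>\<omega>. - (X \<omega> * Y \<omega>)) = distr M borel (\<lambda>\<omega>. X \<omega> * Y \<omega>)"
proof -
  have mult: "distr M borel (\<lambda>\<omega>. A \<omega> * B \<omega>) = distr (distr M borel A \<Otimes>\<^sub>M distr M borel B) borel (\<lambda>(x, y). x * y)"
    if AB: "indep_var borel A borel B" for A B :: "'a \<Rightarrow> real"
  proof -
    from AB have [measurable]: "A \<in> borel_measurable M" "B \<in> borel_measurable M"
      and eq: "distr M borel A \<Otimes>\<^sub>M distr M borel B = distr M (borel \<Otimes>\<^sub>M borel) (\<lambda>\<omega>. (A \<omega>, B \<omega>))"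
      by (auto simp: indep_var_distribution_eq)
    show ?thesis unfolding eq by (subst distr_distr) (auto simp: o_def)
  qed
  have "indep_var borel (uminus \<circ> X) borel (id \<circ> Y)"
    by (rule indep_var_compose[OF indep]) auto
  hence "indep_var borel (\<lambda>\<omega>. - X \<omega>) borel Y" by (simp add: o_def)
  from mult[OF this] mult[OF indep] sym show ?thesis by simp
qed

lemma emeasure_density_lborel_singleton:
  assumes "h \<in> borel_measurable borel"
  shows "emeasure (density lborel h) {x::real} = 0"
proof -
  have "emeasure (density lborel h) {x} = (\<integral>\<^sup>+y. h y * indicator {x} y \<partial>lborel)"
    using assms by (simp add: emeasure_density)
  also have "\<dots> = (\<integral>\<^sup>+y. 0 \<partial>(lborel :: real measure))"
  proof (rule nn_integral_cong_AE)
    show "AE y in lborel. h y * indicator {x} y = 0"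
      using AE_lborel_singleton[of x] by eventually_elim simp
  qed
  finally show ?thesis by simp
qed

lemma (in prob_space) distributed_real_neq_0:
  fixes X :: "'a \<Rightarrow> real"
  assumes "distributed M lborel X f"
  shows "AE \<omega> in M. X \<omega> \<noteq> 0"
proof -
  have "(AE \<omega> in M. X \<omega> \<noteq> 0) \<longleftrightarrow> (AE x in lborel. 0 < f x \<longrightarrow> x \<noteq> 0)"
    by (rule distributed_AE2[OF assms]) measurable
  thus ?thesis using AE_lborel_singleton[of "0::real"] by (auto elim!: eventually_mono)
qed

text \<open>The witness is \<open>fourier_density\<close> of the law of ln |X| + ln |Y|, so the real
  nonnegative values and the G-function formula hold at every y.\<close>

lemma (in prob_space) sym_K_product_density:
  assumes pos: "\<alpha> > 0" "\<zeta> > 0" "\<delta> > 0"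
    and indep: "indep_var borel X borel Y"
    and X: "distributed M lborel X (\<lambda>x. ennreal (sym_K_density \<alpha> \<zeta> \<delta> x))"
    and Y: "distributed M lborel Y (\<lambda>y. ennreal (sym_K_density \<alpha> \<zeta> \<delta> y))"
  defines "a \<equiv> (\<alpha> - \<zeta>) / 2" and "\<mu> \<equiv> (\<alpha> + \<zeta>) / 2"
  shows "\<exists>g :: real \<Rightarrow> complex. (\<forall>y. Re (g y) \<ge> 0 \<and> Im (g y) = 0) \<and>
    (\<forall>y. g y = complex_of_real ((\<delta>\<^sup>2 * exp y) powr \<mu> / (Gamma \<alpha> * Gamma \<zeta>)\<^sup>2) *
       meijer_G 4 0 [] (map complex_of_real [a, - a, a, - a]) (\<delta>\<^sup>2 * exp y)) \<and>
    distributed M lborel (\<lambda>\<omega>. ln \<bar>X \<omega>\<bar> + ln \<bar>Y \<omega>\<bar>) (\<lambda>y. ennreal (Re (g y)))"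
proof -
  let ?U = "\<lambda>\<omega>. ln \<bar>X \<omega>\<bar>" and ?V = "\<lambda>\<omega>. ln \<bar>Y \<omega>\<bar>"
  let ?W = "\<lambda>\<omega>. ln \<bar>X \<omega>\<bar> + ln \<bar>Y \<omega>\<bar>"
  have [measurable]: "X \<in> borel_measurable M" "Y \<in> borel_measurable M"
    using distributed_measurable[OF X] distributed_measurable[OF Y] by auto
  have "indep_var borel ((\<lambda>x. ln \<bar>x\<bar>) \<circ> X) borel ((\<lambda>x. ln \<bar>x\<bar>) \<circ> Y)"
    by (rule indep_var_compose[OF indep]) measurable
  hence UV: "indep_var borel ?U borel ?V" by (simp add: o_def)
  have W: "?W \<in> borel_measurable M" by measurable
  define N where "N = distr M borel ?W"
  interpret N: real_distribution N unfolding N_def by (rule real_distribution_distr[OF W])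
  define G where "G = (\<lambda>t. Gamma (Complex \<alpha> t) * Gamma (Complex \<zeta> t) / of_real (Gamma \<alpha> * Gamma \<zeta>))"
  have charN: "char N t = (iexp (- (t * ln \<delta>)) * G t)\<^sup>2" for t
    unfolding N_def char_distr_add[OF UV] G_def char_ln_abs_sym_K[OF pos X] char_ln_abs_sym_K[OF pos Y]
    by (simp only: power2_eq_square)
  define bs where "bs = [a, - a, a, - a]"
  define f where "f = (\<lambda>x s. (\<Prod>b\<leftarrow>bs. Gamma (complex_of_real b - s)) * complex_of_real x powr s)"
  \<comment> \<open>Since \<mu> + a = \<alpha> and \<mu> - a = \<zeta>, this is positivity of
    \<alpha> and \<zeta>.\<close>
  have c: "- \<mu> < b" if "b \<in> set bs" for b
  proof -
    have "2 * a = \<alpha> - \<zeta>" "2 * \<mu> = \<alpha> + \<zeta>" unfolding a_def \<mu>_def by simp_all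
    hence "- \<mu> < a" "- \<mu> < - a" using pos by linarith+
    thus ?thesis using that unfolding bs_def by auto
  qed
  define K where "K = (\<lambda>y. complex_of_real ((\<delta>\<^sup>2 * exp y) powr \<mu> / (Gamma \<alpha> * Gamma \<zeta>)\<^sup>2))"
  \<comment> \<open>On the line, b - s has imaginary part -t, hence \<open>char N (- t)\<close>. The
    power x^\<mu> in \<open>K y\<close> cancels the modulus of x^s, and the phase of x^s with x =
    \<delta>^2 exp y consists of exp (ity) and the two translation phases.\<close>
  have key: "iexp (t * y) * char N (- t) = K y * f (\<delta>\<^sup>2 * exp y) (Complex (- \<mu>) t)" for t y
  proof -
    define x where "x = \<delta>\<^sup>2 * exp y"
    have x: "x > 0" "ln x = 2 * ln \<delta> + y" using pos by (simp_all add: x_def ln_mult ln_realpow)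
    have "complex_of_real a - Complex (- \<mu>) t = Complex \<alpha> (- t)"
         "complex_of_real (- a) - Complex (- \<mu>) t = Complex \<zeta> (- t)"
      by (simp_all add: complex_eq_iff a_def \<mu>_def field_simps)
    hence prod: "(\<Prod>b\<leftarrow>bs. Gamma (complex_of_real b - Complex (- \<mu>) t))
        = (Gamma (Complex \<alpha> (- t)) * Gamma (Complex \<zeta> (- t)))\<^sup>2"
      by (simp add: bs_def power2_eq_square)
    have "complex_of_real x powr Complex (- \<mu>) t = exp (Complex (- \<mu>) t * of_real (ln x))"
      using x by (simp add: powr_def Ln_of_real)
    also have "Complex (- \<mu>) t * of_real (ln x) = of_real (- \<mu> * ln x) + \<i> * of_real (t * ln x)"
      by (simp add: Complex_eq algebra_simps)
    also have "exp \<dots> = of_real (exp (- \<mu> * ln x)) * iexp (t * ln x)" by (simp only: exp_add exp_of_real)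
    also have "exp (- \<mu> * ln x) = inverse (x powr \<mu>)" using x by (simp add: powr_def exp_minus)
    finally have powr: "complex_of_real x powr Complex (- \<mu>) t = of_real (inverse (x powr \<mu>)) * iexp (t * ln x)" .
    have nz: "x powr \<mu> \<noteq> 0" using x by simp
    have "\<i> * of_real (t * ln x) = \<i> * of_real (t * y) + (\<i> * of_real (- (- t * ln \<delta>)) + \<i> * of_real (- (- t * ln \<delta>)))"
      unfolding x(2) by (simp add: algebra_simps)
    hence iexp: "iexp (t * ln x) = iexp (t * y) * (iexp (- (- t * ln \<delta>)))\<^sup>2"
      by (simp only: exp_add power2_eq_square)
    have "K y * f x (Complex (- \<mu>) t) =
      (of_real (x powr \<mu>) * of_real (inverse (x powr \<mu>))) *
      (iexp (t * y) * ((iexp (- (- t * ln \<delta>)))\<^sup>2 * ((Gamma (Complex \<alpha> (- t)) * Gamma (Complex \<zeta> (- t)))\<^sup>2 / (of_real (Gamma \<alpha> * Gamma \<zeta>))\<^sup>2)))"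
      unfolding K_def f_def x_def[symmetric] prod powr iexp by simp
    also have "of_real (x powr \<mu>) * of_real (inverse (x powr \<mu>)) = (1::complex)"
      using nz by (simp flip: of_real_mult)
    finally show ?thesis unfolding charN G_def x_def[symmetric] power_mult_distrib power_divide by simp
  qed
  have line: "integrable lborel (\<lambda>t. f x (Complex (- \<mu>) t))" if "x > 0" for x
  proof -
    interpret contour_integrand "f x" "{s. \<exists>b\<in>set bs. complex_of_real b - s \<in> \<int>\<^sub>\<le>\<^sub>0}"
      unfolding f_def using that by (intro contour_integrand_prod_Gamma) (simp_all add: bs_def)
    show ?thesis
    proof (rule integrable_vertical_line)
      fix p assume "p \<in> {s. \<exists>b\<in>set bs. complex_of_real b - s \<in> \<int>\<^sub>\<le>\<^sub>0}"
      then obtain b n where b: "b \<in> set bs" "complex_of_real b - p = - of_nat n"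
        by (auto elim: nonpos_Ints_cases')
      hence "p = complex_of_real b + of_nat n" by (simp add: algebra_simps)
      thus "Re p \<noteq> - \<mu>" using c[OF b(1)] by simp
    qed
  qed
  \<comment> \<open>At y = 0 the identity \<open>key\<close> carries integrability over from the
    Mellin-Barnes integrand.\<close>
  have "integrable lborel (\<lambda>t. char N (- t))"
    using integrable_mult_right[OF line[of "\<delta>\<^sup>2 * exp 0"], of "K 0"] key[of _ 0] pos by simp
  from lborel_integrable_real_affine[OF this, of "-1" 0]
  have char_int: "integrable lborel (char N)" by simp
  \<comment> \<open>This convolution density serves to exclude atoms, as the inversion formula
    demands; the explicit density comes from \<open>fourier_density\<close>.\<close>
  have "distributed M lborel ?W (\<lambda>x. \<integral>\<^sup>+y. ennreal (log_K_density \<alpha> \<zeta> (x - y + ln \<delta>)) * ennreal (log_K_density \<alpha> \<zeta> (y + ln \<delta>)) \<partial>lborel)"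
    by (rule distributed_convolution[OF UV distributed_ln_abs_sym_K[OF pos X] distributed_ln_abs_sym_K[OF pos Y]])
  then obtain h where h: "distributed M lborel ?W h" by blast
  have Nh: "N = density lborel h"
    using distributed_distr_eq_density[OF h] unfolding N_def by (simp cong: distr_cong)
  have no_atom: "measure N {y} = 0" for y
    using emeasure_density_lborel_singleton[of h y] distributed_borel_measurable[OF h]
    unfolding Nh by (simp add: measure_def)
  have fd: "N.fourier_density y = K y * meijer_G 4 0 [] (map complex_of_real bs) (\<delta>\<^sup>2 * exp y)" for y
  proof -
    have "N.fourier_density y = 1 / (2 * pi) * (CLBINT t. iexp (- (t * y)) * char N t)"
      by (simp add: N.fourier_density_def)
    also have "(CLBINT t. iexp (- (t * y)) * char N t) = (CLBINT t. iexp (t * y) * char N (- t))"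
      using lborel_integral_real_affine[of "-1" "\<lambda>t. iexp (- (t * y)) * char N t" 0] by simp
    also have "\<dots> = K y * (CLBINT t. f (\<delta>\<^sup>2 * exp y) (Complex (- \<mu>) t))"
      unfolding key by simp
    also have "1 / (2 * pi) * \<dots> = K y * (1 / (2 * of_real pi) * (CLBINT t. f (\<delta>\<^sup>2 * exp y) (Complex (- \<mu>) t)))"
      by simp
    also have "1 / (2 * of_real pi) * (CLBINT t. f (\<delta>\<^sup>2 * exp y) (Complex (- \<mu>) t))
        = meijer_G (length bs) 0 [] (map complex_of_real bs) (\<delta>\<^sup>2 * exp y)"
      unfolding f_def by (rule meijer_G_eq_line_integral[symmetric]) (use pos c in \<open>auto simp: bs_def\<close>)
    also have "length bs = 4" by (simp add: bs_def)
    finally show ?thesis .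
  qed
  have "distributed M lborel ?W (\<lambda>y. ennreal (Re (N.fourier_density y)))"
    unfolding distributed_def
  proof safe
    show "?W \<in> measurable M lborel" by measurable
    show "(\<lambda>y. ennreal (Re (N.fourier_density y))) \<in> borel_measurable lborel"
      using N.measurable_fourier_density[OF char_int no_atom] by simp
    show "distr M lborel ?W = density lborel (\<lambda>y. ennreal (Re (N.fourier_density y)))"
      using N.eq_density_fourier_density[OF char_int no_atom] unfolding N_def by (simp cong: distr_cong)
  qed
  thus ?thesis
    using N.fourier_density_nonneg[OF char_int no_atom] N.fourier_density_real[OF char_int no_atom] fd
    unfolding K_def bs_def by (intro exI[of _ N.fourier_density]) blast
qed

text \<open>Inverse scales multiply, so the argument is \<delta>^2 |z|. With \<delta> |z|, as in the
  English formula at the top, the total mass would be \<delta> to the power (\<alpha> + \<zeta>) /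
  2, which is 1 only for \<delta> = 1. Nonnegativity of \<open>f\<close> is claimed because
  \<open>ennreal\<close> would hide negative values, and the equation between complex numbers makes
  the G-value real. The excluded point z = 0 is null.\<close>

theorem theorem1:
  fixes M :: "'a measure" and X Y :: "'a \<Rightarrow> real" and \<alpha> \<zeta> \<delta> :: real
  assumes "prob_space M"
    and "\<alpha> > 0" and "\<zeta> > 0" and "\<delta> > 0"
    and "prob_space.indep_var M borel X borel Y"
    and "distributed M lborel X (\<lambda>x. ennreal (sym_K_density \<alpha> \<zeta> \<delta> x))"
    and "distributed M lborel Y (\<lambda>y. ennreal (sym_K_density \<alpha> \<zeta> \<delta> y))"
  shows "\<exists>f :: real \<Rightarrow> real.
    (\<forall>z. 0 \<le> f z) \<and>
    (\<forall>z. z \<noteq> 0 \<longrightarrow>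
      complex_of_real (f z) =
        complex_of_real (\<delta> powr (\<alpha> + \<zeta>) * \<bar>z\<bar> powr ((\<alpha> + \<zeta>) / 2 - 1)
          / (2 * (Gamma \<alpha> * Gamma \<zeta>)\<^sup>2))
        * meijer_G 4 0 []
            [complex_of_real ((\<alpha> - \<zeta>) / 2), complex_of_real (- ((\<alpha> - \<zeta>) / 2)),
             complex_of_real ((\<alpha> - \<zeta>) / 2), complex_of_real (- ((\<alpha> - \<zeta>) / 2))]
            (\<delta>\<^sup>2 * \<bar>z\<bar>)) \<and>
    distributed M lborel (\<lambda>\<omega>. X \<omega> * Y \<omega>) (\<lambda>z. ennreal (f z))"
proof -
  interpret prob_space M by fact
  note pos = assms(2-4) and indep = assms(5) and X = assms(6) and Y = assms(7)
  have [measurable]: "X \<in> borel_measurable M" "Y \<in> borel_measurable M"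
    using distributed_measurable[OF X] distributed_measurable[OF Y] by auto
  obtain g where g: "\<And>y. Re (g y) \<ge> 0" "\<And>y. Im (g y) = 0"
    "\<And>y. g y = complex_of_real ((\<delta>\<^sup>2 * exp y) powr ((\<alpha> + \<zeta>) / 2) / (Gamma \<alpha> * Gamma \<zeta>)\<^sup>2) *
       meijer_G 4 0 [] (map complex_of_real [(\<alpha> - \<zeta>) / 2, - ((\<alpha> - \<zeta>) / 2), (\<alpha> - \<zeta>) / 2, - ((\<alpha> - \<zeta>) / 2)]) (\<delta>\<^sup>2 * exp y)"
    "distributed M lborel (\<lambda>\<omega>. ln \<bar>X \<omega>\<bar> + ln \<bar>Y \<omega>\<bar>) (\<lambda>y. ennreal (Re (g y)))"
    using sym_K_product_density[OF pos indep X Y] by blast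
  have nz: "AE \<omega> in M. X \<omega> * Y \<omega> \<noteq> 0"
    using distributed_real_neq_0[OF X] distributed_real_neq_0[OF Y] by eventually_elim simp
  have "AE \<omega> in M. ln \<bar>X \<omega>\<bar> + ln \<bar>Y \<omega>\<bar> = ln \<bar>X \<omega> * Y \<omega>\<bar>"
    using nz by eventually_elim (simp add: abs_mult ln_mult)
  hence "distr M lborel (\<lambda>\<omega>. ln \<bar>X \<omega>\<bar> + ln \<bar>Y \<omega>\<bar>) = distr M lborel (\<lambda>\<omega>. ln \<bar>X \<omega> * Y \<omega>\<bar>)"
    by (intro distr_cong_AE) auto
  hence lnZ: "distributed M lborel (\<lambda>\<omega>. ln \<bar>X \<omega> * Y \<omega>\<bar>) (\<lambda>y. ennreal (Re (g y)))"
    using g(4) unfolding distributed_def by auto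
  have sym: "distr M borel (\<lambda>\<omega>. - (X \<omega> * Y \<omega>)) = distr M borel (\<lambda>\<omega>. X \<omega> * Y \<omega>)"
    by (intro distr_mult_uminus[OF indep] distr_uminus_even[OF X]) (simp add: sym_K_density_def)
  \<comment> \<open>At z = 0 the division by zero makes this 0.\<close>
  define f where "f = (\<lambda>z. Re (g (ln \<bar>z\<bar>)) * (1 / (2 * \<bar>z\<bar>)))"
  have "distributed M lborel (\<lambda>\<omega>. X \<omega> * Y \<omega>) (\<lambda>z. ennreal (Re (g (ln \<bar>z\<bar>))) * ennreal (1 / (2 * \<bar>z\<bar>)))"
    by (rule distributed_of_ln_abs[OF _ nz sym lnZ]) measurable
  hence "distributed M lborel (\<lambda>\<omega>. X \<omega> * Y \<omega>) (\<lambda>z. ennreal (f z))"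
    unfolding f_def by (simp only: ennreal_mult'[OF g(1)])
  moreover have "0 \<le> f z" for z using g(1) by (simp add: f_def)
  moreover have "complex_of_real (f z) =
        complex_of_real (\<delta> powr (\<alpha> + \<zeta>) * \<bar>z\<bar> powr ((\<alpha> + \<zeta>) / 2 - 1)
          / (2 * (Gamma \<alpha> * Gamma \<zeta>)\<^sup>2))
        * meijer_G 4 0 []
            [complex_of_real ((\<alpha> - \<zeta>) / 2), complex_of_real (- ((\<alpha> - \<zeta>) / 2)),
             complex_of_real ((\<alpha> - \<zeta>) / 2), complex_of_real (- ((\<alpha> - \<zeta>) / 2))]
            (\<delta>\<^sup>2 * \<bar>z\<bar>)" if z: "z \<noteq> 0" for z
  proof -
    \<comment> \<open>The square in \<delta>^2 turns the exponent \<mu> into 2 \<mu> = \<alpha> +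
      \<zeta>, and the Jacobian 1 / (2 |z|) lowers that of |z| to \<mu> - 1.\<close>
    define \<mu> where "\<mu> = (\<alpha> + \<zeta>) / 2"
    have "2 * \<mu> = \<alpha> + \<zeta>" unfolding \<mu>_def by simp
    hence "(\<delta>\<^sup>2) powr \<mu> = \<delta> powr (\<alpha> + \<zeta>)" using pos powr_powr[of \<delta> 2 \<mu>] by simp
    hence "(\<delta>\<^sup>2 * \<bar>z\<bar>) powr \<mu> = \<delta> powr (\<alpha> + \<zeta>) * \<bar>z\<bar> powr \<mu>"
      by (simp add: powr_mult)
    hence c: "1 / (2 * \<bar>z\<bar>) * ((\<delta>\<^sup>2 * \<bar>z\<bar>) powr \<mu> / (Gamma \<alpha> * Gamma \<zeta>)\<^sup>2)
        = \<delta> powr (\<alpha> + \<zeta>) * \<bar>z\<bar> powr (\<mu> - 1) / (2 * (Gamma \<alpha> * Gamma \<zeta>)\<^sup>2)"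
      using z by (simp add: powr_diff)
    have e: "exp (ln \<bar>z\<bar>) = \<bar>z\<bar>" using z by simp
    have "complex_of_real (Re (g (ln \<bar>z\<bar>))) = g (ln \<bar>z\<bar>)" using g(2) by (simp add: complex_eq_iff)
    hence "complex_of_real (f z) = complex_of_real (1 / (2 * \<bar>z\<bar>)) * g (ln \<bar>z\<bar>)"
      unfolding f_def by simp
    thus ?thesis
      unfolding g(3)[of "ln \<bar>z\<bar>"] e \<mu>_def[symmetric] c[symmetric] list.map of_real_mult[of "1 / (2 * \<bar>z\<bar>)"]
      by (simp only: mult.assoc)
  qed
  ultimately show ?thesis by (intro exI[of _ f]) blast
qed

end
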